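(* Let $X$ be a curve over $\mathbf{F}_{q^\ell}$ ($\ell\ge 1$), let $P_1,\dots,P_n$ be distinct $\mathbf{F}_{q^\ell}$-rational points of $X$, set $D:=P_1+\cdots+P_n$, and let $G$ be a divisor on $X$ whose support avoids that of $D$. Then the code $Car_q(D,G)$ is a subcode of $C_\Omega(D,G)_{|\mathbf{F}_q}$.
   Context: Let $p$ be a prime, $q$ a power of $p$, and $\ell\ge 1$ an integer. A curve is smooth, projective and geometrically irreducible. For a curve $X$ over $\mathbf{F}_{q^\ell}$, $F$ is its function field and $\Omega_{F/\mathbf{F}_{q^\ell}}$ its space of rational differential forms. For a divisor $A$ on $X$, $\Omega(A):=H^0(X,\Omega_X\otimes\mathcal{O}_X(-A))=\{\omega\in\Omega_{F/\mathbf{F}_{q^\ell}} : v_P(\omega)\ge v_P(A)\text{ for all places }P\}$ (with $v_P(0)=+\infty$). The AG code is $C_\Omega(D,G):=\{(\mathrm{res}_{P_1}(\omega),\dots,\mathrm{res}_{P_n}(\omega)):\omega\in\Omega(G-D)\}\subseteq\mathbf{F}_{q^\ell}^n$. For a code $C\subseteq\mathbf{F}_{q^\ell}^n$, its subfield subcode is $C_{|\mathbf{F}_q}:=C\cap\mathbf{F}_q^n$. Cartier operator: let $x$ be a separating element of $F/\mathbf{F}_{q^\ell}$. Each $\omega\in\Omega_{F/\mathbf{F}_{q^\ell}}$ can be written $\omega=(f_0^p+f_1^px+\cdots+f_{p-1}^px^{p-1})\,dx$ with $f_i\in F$, and $\mathcal{C}(\omega):=f_{p-1}\,dx$ (independent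 of the choice of $x$). If $q=p^m$, then $\mathcal{C}_q:=\mathcal{C}^m$ (the $m$-fold iterate). Let $\Omega(G-D)^{\mathcal{C}_q}:=\{\omega\in\Omega(G-D):\mathcal{C}_q(\omega)=\omega\}$. The Cartier code $Car_q(D,G)$ is the image of the map $\Omega(G-D)^{\mathcal{C}_q}\to\mathbf{F}_{q^\ell}^n$, $\omega\mapsto(\mathrm{res}_{P_1}(\omega),\dots,\mathrm{res}_{P_n}(\omega))$; its elements in fact lie in $\mathbf{F}_q^n$. *)

theory Defs
  imports
    "HOL-Analysis.Finite_Cartesian_Product"
    "HOL-Computational_Algebra.Computational_Algebra"
    "HOL-Library.Poly_Mapping"
begin

text \<open>
  A smooth projective geometrically irreducible curve over a field $K$ is given by its function
  field $F$ together with the embedding \<open>emb\<close> of $K$ (the type \<open>'k\<close>) into $F$ (the type \<open>'f\<close>).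
  Its closed points are the places of $F/K$.
\<close>


section \<open>Function fields of curves\<close>

definition is_subfield :: "'a::field set \<Rightarrow> bool" where
  "is_subfield S \<longleftrightarrow> 0 \<in> S \<and> 1 \<in> S \<and>
     (\<forall>a\<in>S. \<forall>b\<in>S. a - b \<in> S \<and> a * b \<in> S) \<and> (\<forall>a\<in>S. inverse a \<in> S)"

definition field_embedding :: "('k::field \<Rightarrow> 'f::field) \<Rightarrow> bool" where
  "field_embedding emb \<longleftrightarrow>
     emb 1 = 1 \<and> (\<forall>a b. emb (a + b) = emb a + emb b \<and> emb (a * b) = emb a * emb b)"

text \<open>The subfield $K(x)$ of $F$.\<close>

definition adjoin :: "('k::field \<Rightarrow> 'f::field) \<Rightarrow> 'f \<Rightarrow> 'f set" where
  "adjoin emb x = \<Inter>{E. is_subfield E \<and> range emb \<subseteq> E \<and> x \<in> E}"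

definition transcendental :: "('k::field \<Rightarrow> 'f::field) \<Rightarrow> 'f \<Rightarrow> bool" where
  "transcendental emb x \<longleftrightarrow> (\<forall>h. h \<noteq> 0 \<longrightarrow> poly (map_poly emb h) x \<noteq> 0)"

definition finite_over :: "'f::field set \<Rightarrow> bool" where
  "finite_over E \<longleftrightarrow>
     (\<exists>B. finite B \<and> (\<forall>y. \<exists>c. (\<forall>b\<in>B. c b \<in> E) \<and> y = (\<Sum>b\<in>B. c b * b)))"

text \<open>
  The last condition is geometric irreducibility, which can be tested on the finite separable
  extensions of $K$.  Such an extension is $L = K[T]/(h)$ with $h$ irreducible and separable; the
  function ring $F \otimes_K L = F[T]/(h)$ of the base change to $L$ is reduced, so the base change
  is irreducible iff $h$ stays irreducible over $F$.  For perfect $K$ the condition says that $K$ is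
  algebraically closed in $F$.
\<close>

definition function_field_of_curve :: "('k::field \<Rightarrow> 'f::field) \<Rightarrow> bool" where
  "function_field_of_curve emb \<longleftrightarrow>
     field_embedding emb \<and>
     (\<exists>x. transcendental emb x \<and> finite_over (adjoin emb x)) \<and>
     (\<forall>h :: 'k poly. irreducible h \<and> coprime h (pderiv h) \<longrightarrow> irreducible (map_poly emb h))"

definition separable_over :: "'f::field set \<Rightarrow> 'f \<Rightarrow> bool" where
  "separable_over E y \<longleftrightarrow>
     (\<exists>h. (\<forall>i. coeff h i \<in> E) \<and> coprime h (pderiv h) \<and> poly h y = 0)"

definition separating :: "('k::field \<Rightarrow> 'f::field) \<Rightarrow> 'f \<Rightarrow> bool" where
  "separating emb x \<longleftrightarrow>
     transcendental emb x \<and> finite_over (adjoin emb x) \<and> (\<forall>y. separable_over (adjoin emb x) y)"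


section \<open>Places and divisors\<close>

text \<open>
  A place is represented by its normalized discrete valuation $v_P$.  The value $v_P(0) = +\infty$ is
  not available in \<^typ>\<open>int\<close>: the dummy value \<open>0\<close> is stored instead (so that distinct functions are
  distinct places), and zero is treated separately wherever the valuation is used.
\<close>

definition place :: "('k::field \<Rightarrow> 'f::field) \<Rightarrow> ('f \<Rightarrow> int) \<Rightarrow> bool" where
  "place emb v \<longleftrightarrow>
     v 0 = 0 \<and>
     (\<forall>f g. f \<noteq> 0 \<and> g \<noteq> 0 \<longrightarrow> v (f * g) = v f + v g) \<and>
     (\<forall>f g. f \<noteq> 0 \<and> g \<noteq> 0 \<and> f + g \<noteq> 0 \<longrightarrow> v (f + g) \<ge> min (v f) (v g)) \<and>
     (\<forall>a. v (emb a) = 0) \<and>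
     (\<exists>t. v t = 1)"

definition val_ge :: "('f::field \<Rightarrow> int) \<Rightarrow> 'f \<Rightarrow> int \<Rightarrow> bool" where
  "val_ge v f n \<longleftrightarrow> f = 0 \<or> v f \<ge> n"

text \<open>Places of degree one: the residue field is $K$.\<close>

definition rational_place :: "('k::field \<Rightarrow> 'f::field) \<Rightarrow> ('f \<Rightarrow> int) \<Rightarrow> bool" where
  "rational_place emb v \<longleftrightarrow>
     place emb v \<and> (\<forall>f. val_ge v f 0 \<longrightarrow> (\<exists>a. val_ge v (f - emb a) 1))"

type_synonym 'f divisor = "('f \<Rightarrow> int) \<Rightarrow>\<^sub>0 int"

definition is_divisor :: "('k::field \<Rightarrow> 'f::field) \<Rightarrow> 'f divisor \<Rightarrow> bool" where
  "is_divisor emb A \<longleftrightarrow> (\<forall>v\<in>Poly_Mapping.keys A. place emb v)"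

definition point_divisor :: "('n::finite \<Rightarrow> 'f \<Rightarrow> int) \<Rightarrow> 'f divisor" where
  "point_divisor P = (\<Sum>i\<in>UNIV. Poly_Mapping.single (P i) 1)"


section \<open>Rational differential forms\<close>

text \<open>
  $\Omega_{F/K}$ is the module of Kaehler differentials: the free $F$-module on symbols $dx$, $x \in F$
  (\<^term>\<open>Poly_Mapping.single x u\<close> standing for $u\,dx$), modulo the submodule generated by the
  additivity relations, the Leibniz relations and $da$ for $a \in K$.
\<close>

definition kaehler_generators :: "('k::field \<Rightarrow> 'f::field) \<Rightarrow> ('f \<Rightarrow>\<^sub>0 'f) set" where
  "kaehler_generators emb =
     {Poly_Mapping.single (f + g) 1 - Poly_Mapping.single f 1 - Poly_Mapping.single g 1 |f g. True} \<union>
     {Poly_Mapping.single (f * g) 1 - Poly_Mapping.single g f - Poly_Mapping.single f g |f g. True} \<union>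
     {Poly_Mapping.single (emb a) 1 |a. True}"

definition kaehler_rel :: "('k::field \<Rightarrow> 'f::field) \<Rightarrow> (('f \<Rightarrow>\<^sub>0 'f) \<times> ('f \<Rightarrow>\<^sub>0 'f)) set" where
  "kaehler_rel emb =
     {(r, s). s - r \<in> module.span (\<lambda>c. Poly_Mapping.map ((*) c)) (kaehler_generators emb)}"

type_synonym 'f form = "('f \<Rightarrow>\<^sub>0 'f) set"

definition forms :: "('k::field \<Rightarrow> 'f::field) \<Rightarrow> 'f form set" where
  "forms emb = UNIV // kaehler_rel emb"

text \<open>The form $u\,dx$.\<close>

definition form :: "('k::field \<Rightarrow> 'f::field) \<Rightarrow> 'f \<Rightarrow> 'f \<Rightarrow> 'f form" where
  "form emb u x = kaehler_rel emb `` {Poly_Mapping.single x u}"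

definition zero_form :: "('k::field \<Rightarrow> 'f::field) \<Rightarrow> 'f form" where
  "zero_form emb = kaehler_rel emb `` {0}"

text \<open>
  For $\omega \ne 0$: $v_P(\omega) = v_P(u)$ if $\omega = u\,dt$ with $t$ a uniformizer at $P$.
\<close>

definition form_val :: "('k::field \<Rightarrow> 'f::field) \<Rightarrow> ('f \<Rightarrow> int) \<Rightarrow> 'f form \<Rightarrow> int" where
  "form_val emb v \<omega> = (THE k. \<exists>t u. v t = 1 \<and> \<omega> = form emb u t \<and> u \<noteq> 0 \<and> v u = k)"

definition Omega :: "('k::field \<Rightarrow> 'f::field) \<Rightarrow> 'f divisor \<Rightarrow> 'f form set" where
  "Omega emb A = {\<omega> \<in> forms emb. \<omega> = zero_form emb \<or>
     (\<forall>v. place emb v \<longrightarrow> form_val emb v \<omega> \<ge> Poly_Mapping.lookup A v)}"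

text \<open>\<open>L\<close> is the expansion of \<open>u\<close> in powers of the uniformizer \<open>t\<close> at a rational place.\<close>

definition local_expansion ::
    "('k::field \<Rightarrow> 'f::field) \<Rightarrow> ('f \<Rightarrow> int) \<Rightarrow> 'f \<Rightarrow> 'f \<Rightarrow> 'k fls \<Rightarrow> bool" where
  "local_expansion emb v t u L \<longleftrightarrow>
     (\<forall>n. val_ge v (u - (\<Sum>i\<in>{fls_subdegree L..n}. emb (fls_nth L i) * t powi i)) (n + 1))"

definition residue :: "('k::field \<Rightarrow> 'f::field) \<Rightarrow> ('f \<Rightarrow> int) \<Rightarrow> 'f form \<Rightarrow> 'k" where
  "residue emb v \<omega> =
     (THE a. \<exists>t u L. v t = 1 \<and> \<omega> = form emb u t \<and> local_expansion emb v t u L \<and>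
        a = fls_residue L)"

definition cartier :: "('k::field \<Rightarrow> 'f::field) \<Rightarrow> nat \<Rightarrow> 'f form \<Rightarrow> 'f form" where
  "cartier emb p \<omega> =
     (THE \<eta>. \<exists>x f. separating emb x \<and> \<omega> = form emb (\<Sum>i<p. f i ^ p * x ^ i) x \<and>
        \<eta> = form emb (f (p - 1)) x)"


section \<open>Codes\<close>

definition linear_code :: "'k::field set \<Rightarrow> ('k ^ 'n) set \<Rightarrow> bool" where
  "linear_code S C \<longleftrightarrow> (\<forall>c\<in>C. \<forall>i. c $ i \<in> S) \<and> 0 \<in> C \<and>
     (\<forall>c\<in>C. \<forall>d\<in>C. c + d \<in> C) \<and> (\<forall>a\<in>S. \<forall>c\<in>C. a *s c \<in> C)"

text \<open>\<open>C\<close> is a subcode of the code \<open>C'\<close> over the field \<open>S\<close>.\<close>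

definition subcode :: "'k::field set \<Rightarrow> ('k ^ 'n) set \<Rightarrow> ('k ^ 'n) set \<Rightarrow> bool" where
  "subcode S C C' \<longleftrightarrow> linear_code S C \<and> linear_code S C' \<and> C \<subseteq> C'"

definition subfield_subcode :: "'k::field set \<Rightarrow> ('k ^ 'n) set \<Rightarrow> ('k ^ 'n) set" where
  "subfield_subcode S C = C \<inter> {c. \<forall>i. c $ i \<in> S}"

definition residues ::
    "('k::field \<Rightarrow> 'f::field) \<Rightarrow> ('n \<Rightarrow> 'f \<Rightarrow> int) \<Rightarrow> 'f form \<Rightarrow> 'k ^ 'n" where
  "residues emb P \<omega> = (\<chi> i. residue emb (P i) \<omega>)"

text \<open>
  In both codes $D = P_1 + \cdots + P_n$ is \<^term>\<open>point_divisor P\<close>; the family \<open>P\<close> also fixes the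
  order of the coordinates.
\<close>

definition AG_code ::
    "('k::field \<Rightarrow> 'f::field) \<Rightarrow> ('n::finite \<Rightarrow> 'f \<Rightarrow> int) \<Rightarrow> 'f divisor \<Rightarrow> ('k ^ 'n) set" where
  "AG_code emb P G = residues emb P ` Omega emb (G - point_divisor P)"

text \<open>Here $q = p^m$, so $\mathcal{C}_q$ is the \<open>m\<close>-fold iterate of the Cartier operator.\<close>

definition Cartier_code ::
    "('k::field \<Rightarrow> 'f::field) \<Rightarrow> nat \<Rightarrow> nat \<Rightarrow> ('n::finite \<Rightarrow> 'f \<Rightarrow> int) \<Rightarrow> 'f divisor \<Rightarrow>
      ('k ^ 'n) set" where
  "Cartier_code emb p m P G =
     residues emb P ` {\<omega> \<in> Omega emb (G - point_divisor P). (cartier emb p ^^ m) \<omega> = \<omega>}"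

end

theory Submission
  imports Defs
begin

text \<open>
  Let \<open>t\<close> be a uniformizer at some place.  Because $[F : F^p] = p$, the powers $t^i$ with $i < p$
  form a basis of $F$ over $F^p$; write $f = \sum_i c_i(f)^p t^i$.  The derivation
  $\theta = t\,d/dt$ is $f \mapsto \sum_i i\, c_i(f)^p t^i$, and $u\,dx \mapsto u\,\theta(x)$
  identifies $\Omega_{F/K}$ with $F$ by sending $w\,dt/t$ to $w$.  In this coordinate the Cartier
  operator is $w \mapsto c_0(w)$, hence additive and $p^{-1}$-linear.  At a place with uniformizer
  \<open>t\<close> the valuation of $w\,dt/t$ is $v(w) - 1$, and at a rational place where this is at least $-1$
  the residue is the residue class of $w$.  Since $w \equiv c_0(w)^p$ modulo $t$, the residue of
  a form with at most a simple pole is the $p$-th power of the residue of its image under the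
  Cartier operator.  For a form fixed by $\mathcal{C}_q$ the residues therefore satisfy $a^q = a$,
  that is, they lie in $\mathbf{F}_q$.
\<close>

section \<open>Linear algebra over subfields\<close>

text \<open>\<open>form_val\<close>, \<open>residue\<close> and \<open>cartier\<close> are definite
  descriptions over all presentations of a form, so each needs a presentation and independence of
  it. For \<open>cartier\<close>, independence comes from C(x^(p-1) dx) = dx; a presentation comes
  from a uniformizer, which has to be shown to be separating first. For \<open>residue\<close>,
  independence of the uniformizer is delicate in characteristic p when poles have higher order. But
  G and D have disjoint supports, so G - D has coefficient -1 at each P_i and only simple poles
  occur; there it suffices that two uniformizers s, t at a place satisfy s = t ds/dt modulo t^2. The
  form dt/t is the unit of the coordinate because the Cartier operator fixes it and its residue is
  1, so no index shift remains. Adding forms needs one coordinate for all places, whereas valuations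
  and residues need a uniformizer at the place in question: a global \<open>t\<close> is kept, and
  at each place the coordinate is multiplied by s / theta(s).\<close>

lemma is_subfieldD:
  assumes "is_subfield E"
  shows "0 \<in> E" "1 \<in> E" "\<And>a b. a \<in> E \<Longrightarrow> b \<in> E \<Longrightarrow> a - b \<in> E"
    "\<And>a b. a \<in> E \<Longrightarrow> b \<in> E \<Longrightarrow> a * b \<in> E" "\<And>a. a \<in> E \<Longrightarrow> inverse a \<in> E"
    "\<And>a. a \<in> E \<Longrightarrow> - a \<in> E" "\<And>a b. a \<in> E \<Longrightarrow> b \<in> E \<Longrightarrow> a + b \<in> E"
    "\<And>a b. a \<in> E \<Longrightarrow> b \<in> E \<Longrightarrow> a / b \<in> E"
proof -
  show *: "0 \<in> E" "1 \<in> E" "\<And>a b. a \<in> E \<Longrightarrow> b \<in> E \<Longrightarrow> a - b \<in> E"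
    "\<And>a b. a \<in> E \<Longrightarrow> b \<in> E \<Longrightarrow> a * b \<in> E" "\<And>a. a \<in> E \<Longrightarrow> inverse a \<in> E"
    using assms by (auto simp: is_subfield_def)
  show neg: "- a \<in> E" if "a \<in> E" for a
    using *(3)[OF *(1) that] by simp
  show "a + b \<in> E" if "a \<in> E" "b \<in> E" for a b
    using *(3)[OF that(1) neg[OF that(2)]] by simp
  show "a / b \<in> E" if "a \<in> E" "b \<in> E" for a b
    using *(4)[OF that(1) *(5)[OF that(2)]] by (simp add: divide_inverse)
qed

lemma is_subfield_power: "is_subfield E \<Longrightarrow> a \<in> E \<Longrightarrow> a ^ n \<in> E"
  by (induction n) (auto intro: is_subfieldD)

lemma is_subfield_sum: "is_subfield E \<Longrightarrow> (\<And>i. i \<in> A \<Longrightarrow> f i \<in> E) \<Longrightarrow> sum f A \<in> E"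
  by (induction A rule: infinite_finite_induct) (auto intro: is_subfieldD)

lemma is_subfield_adjoin: "is_subfield (adjoin emb x)"
  unfolding is_subfield_def adjoin_def by auto

lemma adjoin_gen: "x \<in> adjoin emb x"
  by (simp add: adjoin_def)

lemma adjoin_emb: "emb a \<in> adjoin emb x"
  by (auto simp: adjoin_def)

lemma adjoin_minimal: "is_subfield E \<Longrightarrow> range emb \<subseteq> E \<Longrightarrow> x \<in> E \<Longrightarrow> adjoin emb x \<subseteq> E"
  by (auto simp: adjoin_def)

text \<open>Gaussian elimination, by induction on the set \<open>B\<close> of equations. Every
  coefficient and the solution have to stay in the subset \<open>E\<close>.\<close>

lemma homogeneous_system_nontrivial:
  assumes E: "is_subfield E" and "finite B" "finite I" "card B < card I"
    and "\<And>i b. i \<in> I \<Longrightarrow> b \<in> B \<Longrightarrow> c i b \<in> E"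
  shows "\<exists>d. (\<forall>i. d i \<in> E) \<and> (\<exists>i\<in>I. d i \<noteq> 0) \<and> (\<forall>b\<in>B. (\<Sum>i\<in>I. d i * c i b) = 0)"
  using assms(2-)
proof (induction B arbitrary: I c rule: finite_induct)
  case empty
  then show ?case
    by (intro exI[of _ "\<lambda>_. 1"]) (auto simp: is_subfieldD[OF E] card_gt_0_iff)
next
  case (insert b0 B)
  show ?case
  proof (cases "\<forall>i\<in>I. c i b0 = 0")
    case True
    have "card B < card I"
      using insert by auto
    with insert.IH[of I c] insert.prems
    obtain d where "\<forall>i. d i \<in> E" "\<exists>i\<in>I. d i \<noteq> 0" "\<forall>b\<in>B. (\<Sum>i\<in>I. d i * c i b) = 0"
      by auto
    with True show ?thesis by (intro exI[of _ d]) auto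
  next
    case False
    then obtain i0 where i0: "i0 \<in> I" "c i0 b0 \<noteq> 0" by auto
    \<comment> \<open>The equation \<open>b0\<close> is solved for the pivot unknown
      \<open>i0\<close>; \<open>c'\<close> is the system that remains after substituting for it, and
      \<open>d'\<close> recovers the eliminated unknown.\<close>
    define J where "J = I - {i0}"
    define c' where "c' i b = c i b - c i b0 / c i0 b0 * c i0 b" for i b
    have IJ: "I = insert i0 J" "i0 \<notin> J" "finite J"
      using i0 insert.prems by (auto simp: J_def)
    have "card B < card J"
      using insert IJ by auto
    moreover have "c' i b \<in> E" if "i \<in> J" "b \<in> B" for i b
      using that insert.prems(3) i0 unfolding c'_def IJ(1)
      by (intro is_subfieldD[OF E]) auto
    ultimately obtain d where d: "\<forall>i. d i \<in> E" "\<exists>i\<in>J. d i \<noteq> 0"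
      "\<forall>b\<in>B. (\<Sum>i\<in>J. d i * c' i b) = 0"
      using insert.IH[of J c'] IJ by auto
    define d' where "d' = d(i0 := - (\<Sum>i\<in>J. d i * (c i b0 / c i0 b0)))"
    have dJ: "d' i = d i" if "i \<in> J" for i
      using that IJ by (auto simp: d'_def)
    have split: "(\<Sum>i\<in>I. d' i * c i b) = (\<Sum>i\<in>J. d i * c' i b)" for b
    proof -
      have "(\<Sum>i\<in>I. d' i * c i b) = d' i0 * c i0 b + (\<Sum>i\<in>J. d i * c i b)"
        using IJ dJ by simp
      also have "d' i0 * c i0 b = - (\<Sum>i\<in>J. d i * (c i b0 / c i0 b0 * c i0 b))"
        by (simp add: d'_def sum_distrib_right mult.assoc)
      finally show ?thesis
        by (simp add: c'_def algebra_simps sum_subtractf)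
    qed
    have "(\<Sum>i\<in>I. d' i * c i b) = 0" if "b \<in> insert b0 B" for b
      using that d(3) i0 unfolding split by (auto simp: c'_def)
    moreover have "d' i \<in> E" for i
      using d insert.prems(3) i0 unfolding d'_def IJ(1)
      by (auto intro!: is_subfieldD[OF E] is_subfield_sum[OF E])
    moreover have "\<exists>i\<in>I. d' i \<noteq> 0"
      using d(2) dJ IJ by auto
    ultimately show ?thesis by blast
  qed
qed

text \<open>A relation between the coefficient vectors of the \<open>f i\<close> along
  \<open>g\<close> is a relation between the \<open>f i\<close> themselves. The family
  \<open>g\<close> need not be independent.\<close>

lemma linear_dependence_over_subfield:
  assumes E: "is_subfield E" and fin: "finite B" "finite I" and card: "card B < card I"
    and c: "\<And>i b. i \<in> I \<Longrightarrow> b \<in> B \<Longrightarrow> c i b \<in> E"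
    and f: "\<And>i. i \<in> I \<Longrightarrow> f i = (\<Sum>b\<in>B. c i b * g b)"
  shows "\<exists>d. (\<forall>i. d i \<in> E) \<and> (\<exists>i\<in>I. d i \<noteq> 0) \<and> (\<Sum>i\<in>I. d i * f i) = 0"
proof -
  obtain d where d: "\<forall>i. d i \<in> E" "\<exists>i\<in>I. d i \<noteq> 0" "\<forall>b\<in>B. (\<Sum>i\<in>I. d i * c i b) = 0"
    using homogeneous_system_nontrivial[of E B I c, OF E fin card c] by blast
  have "(\<Sum>i\<in>I. d i * f i) = (\<Sum>i\<in>I. \<Sum>b\<in>B. d i * c i b * g b)"
    by (intro sum.cong) (auto simp: f sum_distrib_left mult.assoc)
  also have "\<dots> = (\<Sum>b\<in>B. (\<Sum>i\<in>I. d i * c i b) * g b)"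
    by (subst sum.swap) (simp add: sum_distrib_right)
  also have "\<dots> = 0"
    using d by simp
  finally show ?thesis using d by blast
qed

lemma finite_over_obtain_basis:
  assumes E: "is_subfield E" and "finite_over E"
  obtains B where "finite B" "B \<noteq> {}" "\<forall>y. \<exists>c. (\<forall>b\<in>B. c b \<in> E) \<and> y = (\<Sum>b\<in>B. c b * b)"
    "\<forall>c. (\<forall>b\<in>B. c b \<in> E) \<longrightarrow> (\<Sum>b\<in>B. c b * b) = 0 \<longrightarrow> (\<forall>b\<in>B. c b = 0)"
proof -
  define spans where
    "spans B \<longleftrightarrow> finite B \<and> (\<forall>y. \<exists>c. (\<forall>b\<in>B. c b \<in> E) \<and> y = (\<Sum>b\<in>B. c b * b))" for B
  obtain B0 where "spans B0"
    using assms(2) unfolding finite_over_def spans_def by blast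
  then obtain B where B: "spans B" and min: "\<And>B'. spans B' \<Longrightarrow> card B \<le> card B'"
    using ex_has_least_nat[of spans B0 card] by blast
  have ne: "B \<noteq> {}"
  proof
    assume "B = {}"
    then have "\<forall>y::'a. y = 0"
      using B unfolding spans_def by auto
    then have "(1::'a) = 0" by blast
    then show False by simp
  qed
  have indep: "c b0 = 0"
    if c: "\<And>b. b \<in> B \<Longrightarrow> c b \<in> E" "(\<Sum>b\<in>B. c b * b) = 0" and b0: "b0 \<in> B" for c b0
  proof (rule ccontr)
    assume nz: "c b0 \<noteq> 0"
    define B' where "B' = B - {b0}"
    have BB: "B = insert b0 B'" "b0 \<notin> B'" "finite B'"
      using b0 B by (auto simp: B'_def spans_def)
    have "c b0 * b0 = - (\<Sum>b\<in>B'. c b * b)"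
      using c(2) BB by (simp add: eq_neg_iff_add_eq_0)
    then have "b0 = - (\<Sum>b\<in>B'. c b * b) / c b0"
      using nz by (simp add: field_simps)
    then have b0_eq: "b0 = (\<Sum>b\<in>B'. - (c b / c b0) * b)"
      by (simp add: sum_negf sum_divide_distrib)
    have "\<exists>e. (\<forall>b\<in>B'. e b \<in> E) \<and> y = (\<Sum>b\<in>B'. e b * b)" for y
    proof -
      obtain e where e: "\<forall>b\<in>B. e b \<in> E" "y = (\<Sum>b\<in>B. e b * b)"
        using B unfolding spans_def by blast
      define e' where "e' b = e b - e b0 * (c b / c b0)" for b
      have "y = e b0 * b0 + (\<Sum>b\<in>B'. e b * b)"
        using e BB by simp
      also have "\<dots> = (\<Sum>b\<in>B'. e' b * b)"
        unfolding e'_def by (subst (2) b0_eq) (simp add: algebra_simps sum_distrib_left sum_subtractf sum_negf)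
      finally have "y = (\<Sum>b\<in>B'. e' b * b)" .
      moreover have "e' b \<in> E" if "b \<in> B'" for b
        using that e(1) c(1) BB unfolding e'_def by (intro is_subfieldD[OF E]) auto
      ultimately show ?thesis by blast
    qed
    then have "spans B'"
      using BB by (auto simp: spans_def)
    from min[OF this] BB show False by simp
  qed
  show ?thesis
    by (rule that[of B]) (use B ne indep in \<open>auto simp: spans_def\<close>)
qed


section \<open>Fields of characteristic p\<close>

locale prime_char =
  fixes p :: nat and F :: "'f::field itself"
  assumes prime_p: "prime p" and CHAR_eq: "CHAR('f) = p"
begin

lemma p_gt_1: "1 < p" and p_pos: "0 < p"
  using prime_p prime_gt_1_nat prime_gt_0_nat by auto

lemma frob_add: "((a::'f) + b) ^ p = a ^ p + b ^ p"
  by (rule freshmans_dream) (auto simp: prime_p CHAR_eq)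

lemma frob_sum: "(sum f A :: 'f) ^ p = (\<Sum>i\<in>A. f i ^ p)"
  by (rule freshmans_dream_sum) (auto simp: prime_p CHAR_eq)

lemma frob_diff: "((a::'f) - b) ^ p = a ^ p - b ^ p"
  using frob_add[of "a - b" b] by simp

lemma frob_minus: "(- (a::'f)) ^ p = - (a ^ p)"
  using frob_diff[of 0 a] p_pos by (simp add: zero_power)

lemma frob_0: "(0::'f) ^ p = 0"
  using p_pos by (simp add: zero_power)

lemma frob_inj: "(a::'f) ^ p = b ^ p \<longleftrightarrow> a = b"
  using frob_diff[of a b] by auto

lemma of_nat_p: "of_nat p = (0::'f)"
  using of_nat_CHAR[where 'a='f] CHAR_eq by simp

lemma of_nat_neq_0: "0 < i \<Longrightarrow> i < p \<Longrightarrow> of_nat i \<noteq> (0::'f)"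
  using of_nat_eq_0_iff_char_dvd[where 'a='f] CHAR_eq by (auto dest: dvd_imp_le)

text \<open>Fermat's little theorem, from additivity of the Frobenius. It lets integers pass as p-th
  powers, that is, as scalars for \<open>theta\<close> and \<open>kappa\<close>.\<close>

lemma frob_of_nat: "(of_nat i :: 'f) ^ p = of_nat i"
  by (induction i) (auto simp: frob_add frob_0)

text \<open>
  For a subfield $E$ and $x \in E$ this is the field $E^p(x)$.
\<close>

definition frob_span :: "'f set \<Rightarrow> 'f \<Rightarrow> 'f set" where
  "frob_span E x = {\<Sum>k<p. e k ^ p * x ^ k |e. \<forall>k. e k \<in> E}"

lemma frob_span_monomial:
  assumes E: "is_subfield E" and "x \<in> E" "g \<in> E"
  shows "g ^ p * x ^ n \<in> frob_span E x"
proof -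
  \<comment> \<open>Division with remainder: x^n is the p-th power of x^(n div p) times x^(n mod p),
    so a single coefficient suffices.\<close>
  define e where "e k = (if k = n mod p then g * x ^ (n div p) else 0)" for k
  have "(\<Sum>k<p. e k ^ p * x ^ k)
      = (\<Sum>k<p. if k = n mod p then (g * x ^ (n div p)) ^ p * x ^ k else 0)"
    by (intro sum.cong) (auto simp: e_def frob_0)
  also have "\<dots> = g ^ p * ((x ^ (n div p)) ^ p * x ^ (n mod p))"
    using p_pos by (simp add: power_mult_distrib mult.assoc)
  also have "(x ^ (n div p)) ^ p * x ^ (n mod p) = x ^ n"
    by (metis div_mult_mod_eq power_add power_mult)
  finally show ?thesis
    using assms unfolding frob_span_def
    by (auto simp: e_def intro!: exI[of _ e] is_subfieldD[OF E] is_subfield_power[OF E])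
qed

lemma frob_span_diff:
  assumes E: "is_subfield E" and "a \<in> frob_span E x" "b \<in> frob_span E x"
  shows "a - b \<in> frob_span E x"
proof -
  obtain e e' where "\<forall>k. e k \<in> E" "\<forall>k. e' k \<in> E"
    "a = (\<Sum>k<p. e k ^ p * x ^ k)" "b = (\<Sum>k<p. e' k ^ p * x ^ k)"
    using assms by (auto simp: frob_span_def)
  then show ?thesis
    unfolding frob_span_def
    by (auto intro!: exI[of _ "\<lambda>k. e k - e' k"] is_subfieldD[OF E]
        simp: frob_diff left_diff_distrib sum_subtractf)
qed

lemma frob_span_0: "is_subfield E \<Longrightarrow> 0 \<in> frob_span E x"
  unfolding frob_span_def by (auto intro!: exI[of _ "\<lambda>_. 0"] simp: frob_0 is_subfieldD)

lemma frob_span_sum: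
  assumes E: "is_subfield E" and "\<And>i. i \<in> A \<Longrightarrow> f i \<in> frob_span E x"
  shows "sum f A \<in> frob_span E x"
  using assms(2)
proof (induction A rule: infinite_finite_induct)
  case (insert i A)
  have "f i - (0 - sum f A) \<in> frob_span E x"
    using insert by (intro frob_span_diff[OF E] frob_span_0[OF E]) auto
  then show ?case
    using insert by simp
qed (auto simp: frob_span_0[OF E])

lemma frob_span_subset:
  assumes E: "is_subfield E" and "x \<in> E"
  shows "frob_span E x \<subseteq> E"
  using assms(2) unfolding frob_span_def
  by (auto intro!: is_subfield_sum[OF E] is_subfieldD[OF E] is_subfield_power[OF E])

lemma frob_span_mult:
  assumes E: "is_subfield E" and x: "x \<in> E" and "a \<in> frob_span E x" "b \<in> frob_span E x"
  shows "a * b \<in> frob_span E x"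
proof -
  obtain e e' where e: "\<forall>k. e k \<in> E" "\<forall>k. e' k \<in> E"
    "a = (\<Sum>k<p. e k ^ p * x ^ k)" "b = (\<Sum>k<p. e' k ^ p * x ^ k)"
    using assms by (auto simp: frob_span_def)
  have "a * b = (\<Sum>i<p. \<Sum>j<p. (e i * e' j) ^ p * x ^ (i + j))"
    unfolding e sum_product by (simp add: power_mult_distrib power_add mult_ac)
  also have "\<dots> \<in> frob_span E x"
    using e x by (intro frob_span_sum[OF E] frob_span_monomial[OF E]) (auto intro: is_subfieldD[OF E])
  finally show ?thesis .
qed

lemma is_subfield_frob_span:
  assumes E: "is_subfield E" and x: "x \<in> E"
  shows "is_subfield (frob_span E x)"
proof -
  have pow: "g ^ p \<in> frob_span E x" if "g \<in> E" for g
    using frob_span_monomial[OF E x that, of 0] by simp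
  have one: "1 \<in> frob_span E x"
    using pow[of 1] is_subfieldD[OF E] by simp
  \<comment> \<open>The inverse is a^(p-1) times the p-th power of 1/a. Since 1/a lies in
    \<open>E\<close>, that p-th power is already in the span.\<close>
  have "inverse a \<in> frob_span E x" if a: "a \<in> frob_span E x" for a
  proof (cases "a = 0")
    case False
    have "a ^ n \<in> frob_span E x" for n
      by (induction n) (auto intro: one frob_span_mult[OF E x] a)
    moreover have "inverse a ^ p \<in> frob_span E x"
      using a frob_span_subset[OF E x] by (intro pow) (auto intro: is_subfieldD[OF E])
    ultimately have "a ^ (p - 1) * inverse a ^ p \<in> frob_span E x"
      by (rule frob_span_mult[OF E x])
    also have "a ^ (p - 1) * inverse a ^ p = inverse a"
      using False p_pos by (cases p) (auto simp: field_simps)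
    finally show ?thesis .
  qed (simp add: frob_span_0[OF E])
  then show ?thesis
    using one frob_span_0[OF E] frob_span_diff[OF E] frob_span_mult[OF E x]
    by (auto simp: is_subfield_def)
qed

lemma is_subfield_frob_image:
  assumes E: "is_subfield E"
  shows "is_subfield ((\<lambda>a. a ^ p) ` (E :: 'f set))"
  unfolding is_subfield_def
proof (intro conjI ballI)
  show "0 \<in> (\<lambda>a. a ^ p) ` E" "1 \<in> (\<lambda>a. a ^ p) ` E"
    using is_subfieldD(1,2)[OF E] frob_0 by (auto intro: image_eqI[of _ _ 0] image_eqI[of _ _ 1])
  fix a b assume "a \<in> (\<lambda>a. a ^ p) ` E" "b \<in> (\<lambda>a. a ^ p) ` E"
  then show "a - b \<in> (\<lambda>a. a ^ p) ` E" "a * b \<in> (\<lambda>a. a ^ p) ` E"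
    by (auto simp flip: frob_diff power_mult_distrib intro!: imageI is_subfieldD[OF E])
next
  fix a assume "a \<in> (\<lambda>a. a ^ p) ` E"
  then show "inverse a \<in> (\<lambda>a. a ^ p) ` E"
    by (auto simp flip: power_inverse intro!: imageI is_subfieldD[OF E])
qed

text \<open>
  This is $[F : F^p] \le p$: if $F$ has the basis $B$ over $E$, then $p + 1$ elements
  independent over $F^p$ times the $p$-th powers of $B$ would be too many elements independent
  over $E^p$, because $[F : E^p] \le p\,|B|$.
\<close>

lemma frob_dependence:
  fixes x :: 'f and y :: "nat \<Rightarrow> 'f"
  assumes E: "is_subfield E" and fin: "finite_over E" and Ex: "E \<subseteq> frob_span E x"
  obtains c where "\<exists>i\<le>p. c i \<noteq> 0" "(\<Sum>i\<le>p. c i ^ p * y i) = 0"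
proof -
  obtain B where B: "finite B" "B \<noteq> {}" "\<forall>y. \<exists>c. (\<forall>b\<in>B. c b \<in> E) \<and> y = (\<Sum>b\<in>B. c b * b)"
    "\<forall>c. (\<forall>b\<in>B. c b \<in> E) \<longrightarrow> (\<Sum>b\<in>B. c b * b) = 0 \<longrightarrow> (\<forall>b\<in>B. c b = 0)"
    using finite_over_obtain_basis[OF E fin] by blast
  \<comment> \<open>\<open>I\<close> indexes the products y_i b^p, \<open>J\<close> the elements x^k
    b, which span F over the p-th powers of \<open>E\<close>.\<close>
  define I J where "I = {..p} \<times> B" and "J = {..<p} \<times> B"
  have fin: "finite I" "finite J" and card: "card J < card I"
    using B(1,2) by (auto simp: I_def J_def card_cartesian_product card_gt_0_iff)
  have "\<exists>e. (\<forall>kb. e kb \<in> E) \<and> z = (\<Sum>kb\<in>J. e kb ^ p * (x ^ fst kb * snd kb))" for z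
  proof -
    obtain c where c: "\<forall>b\<in>B. c b \<in> E" "z = (\<Sum>b\<in>B. c b * b)"
      using B(3) by blast
    have "\<forall>b\<in>B. \<exists>e. (\<forall>k. e k \<in> E) \<and> c b = (\<Sum>k<p. e k ^ p * x ^ k)"
      using c(1) Ex unfolding frob_span_def by blast
    then obtain e where e: "\<forall>b\<in>B. (\<forall>k. e b k \<in> E) \<and> c b = (\<Sum>k<p. e b k ^ p * x ^ k)"
      by metis
    \<comment> \<open>The value zero outside \<open>B\<close> keeps all coefficients in
      \<open>E\<close>, also at pairs that do not belong to \<open>J\<close>.\<close>
    define e' where "e' kb = (if snd kb \<in> B then e (snd kb) (fst kb) else 0)" for kb
    have "z = (\<Sum>b\<in>B. \<Sum>k<p. e b k ^ p * (x ^ k * b))"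
      unfolding c(2) using e by (intro sum.cong) (auto simp: sum_distrib_right mult.assoc)
    also have "\<dots> = (\<Sum>k<p. \<Sum>b\<in>B. e' (k, b) ^ p * (x ^ k * b))"
      by (subst sum.swap) (auto simp: e'_def intro!: sum.cong)
    also have "\<dots> = (\<Sum>kb\<in>J. e' kb ^ p * (x ^ fst kb * snd kb))"
      by (simp add: J_def sum.cartesian_product case_prod_beta)
    finally show ?thesis
      using e is_subfieldD(1)[OF E] by (intro exI[of _ e']) (auto simp: e'_def)
  qed
  then obtain e where e: "\<And>z kb. e z kb \<in> E" "\<And>z. z = (\<Sum>kb\<in>J. e z kb ^ p * (x ^ fst kb * snd kb))"
    by metis
  define c' where "c' i kb = e (y (fst i) * snd i ^ p) kb ^ p" for i kb
  have c': "c' i kb \<in> (\<lambda>a. a ^ p) ` E" for i kb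
    unfolding c'_def using e(1) by (rule imageI)
  have f: "y (fst i) * snd i ^ p = (\<Sum>kb\<in>J. c' i kb * (x ^ fst kb * snd kb))" for i
    unfolding c'_def by (rule e(2))
  have "\<exists>d. (\<forall>i. d i \<in> (\<lambda>a. a ^ p) ` E) \<and> (\<exists>i\<in>I. d i \<noteq> 0)
      \<and> (\<Sum>i\<in>I. d i * (y (fst i) * snd i ^ p)) = 0"
  proof (rule linear_dependence_over_subfield)
    show "is_subfield ((\<lambda>a. a ^ p) ` E)" by (rule is_subfield_frob_image[OF E])
  qed (rule fin card c' f)+
  then obtain d where d: "\<forall>i. d i \<in> (\<lambda>a. a ^ p) ` E" "\<exists>i\<in>I. d i \<noteq> 0"
    "(\<Sum>i\<in>I. d i * (y (fst i) * snd i ^ p)) = 0"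
    by blast
  have "\<forall>i. \<exists>h. h \<in> E \<and> d i = h ^ p"
    using d(1) by blast
  then obtain h where h: "\<And>i. h i \<in> E" "\<And>i. d i = h i ^ p"
    by metis
  \<comment> \<open>By additivity of the Frobenius the p-th power of \<open>c i\<close> collects all
    terms h^p b^p that multiply y_i. Independence of \<open>B\<close> makes some \<open>c i\<close>
    nonzero.\<close>
  define c where "c i = (\<Sum>b\<in>B. h (i, b) * b)" for i
  have "(\<Sum>i\<le>p. c i ^ p * y i) = (\<Sum>i\<le>p. \<Sum>b\<in>B. d (i, b) * (y i * b ^ p))"
    by (simp add: c_def frob_sum h power_mult_distrib sum_distrib_left sum_distrib_right mult_ac)
  also have "\<dots> = 0"
    using d(3) by (simp add: I_def sum.cartesian_product case_prod_beta)
  finally have sum0: "(\<Sum>i\<le>p. c i ^ p * y i) = 0" .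
  obtain i b where ib: "i \<le> p" "b \<in> B" "h (i, b) \<noteq> 0"
    using d(2) h(2) frob_0 by (auto simp: I_def)
  have "c i \<noteq> 0"
    using B(4)[rule_format, of "\<lambda>b. h (i, b)" b] h(1) ib by (auto simp: c_def)
  with ib(1) sum0 that show ?thesis by blast
qed

end


section \<open>The Cartier operator in coordinates\<close>

locale p_basis = prime_char p "TYPE('f)" for p :: nat and t :: "'f::field" +
  assumes ex_expansion: "\<exists>c. f = (\<Sum>i<p. c i ^ p * t ^ i)"
    and expansion_0: "(\<Sum>i<p. c i ^ p * t ^ i) = 0 \<Longrightarrow> i < p \<Longrightarrow> c i = 0"
begin

text \<open>Only the values at indices below \<open>p\<close> are determined by the expansion, hence
  the hypothesis \<open>i < p\<close> in the rules that follow.\<close>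

definition coord :: "'f \<Rightarrow> nat \<Rightarrow> 'f" where
  "coord f = (SOME c. f = (\<Sum>i<p. c i ^ p * t ^ i))"

lemma coord_expansion: "(\<Sum>i<p. coord f i ^ p * t ^ i) = f"
  unfolding coord_def using someI_ex[OF ex_expansion, of f] by (rule sym)

lemma coord_unique:
  assumes "f = (\<Sum>i<p. c i ^ p * t ^ i)" "i < p"
  shows "coord f i = c i"
proof -
  have "(\<Sum>i<p. (coord f i - c i) ^ p * t ^ i) = f - f"
    unfolding frob_diff left_diff_distrib sum_subtractf
    by (subst coord_expansion) (simp flip: assms(1))
  then have "(\<Sum>i<p. (coord f i - c i) ^ p * t ^ i) = 0"
    by simp
  from expansion_0[OF this assms(2)] show ?thesis by simp
qed

lemma coord_add: "i < p \<Longrightarrow> coord (f + g) i = coord f i + coord g i"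
  by (rule coord_unique) (simp_all add: frob_add distrib_right sum.distrib coord_expansion)

lemma coord_frob_mult: "i < p \<Longrightarrow> coord (a ^ p * f) i = a * coord f i"
  by (rule coord_unique)
    (simp_all add: power_mult_distrib mult.assoc coord_expansion flip: sum_distrib_left)

lemma coord_power: "i < p \<Longrightarrow> coord (t ^ n) i = (if i = n mod p then t ^ (n div p) else 0)"
proof (rule coord_unique)
  have "(\<Sum>i<p. (if i = n mod p then t ^ (n div p) else 0) ^ p * t ^ i)
      = (\<Sum>i<p. if i = n mod p then (t ^ (n div p)) ^ p * t ^ i else 0)"
    by (intro sum.cong) (auto simp: frob_0)
  also have "\<dots> = (t ^ (n div p)) ^ p * t ^ (n mod p)"
    using p_pos by simp
  also have "\<dots> = t ^ n"
    by (metis div_mult_mod_eq power_add power_mult)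
  finally show "t ^ n = (\<Sum>i<p. (if i = n mod p then t ^ (n div p) else 0) ^ p * t ^ i)" ..
qed

lemma t_nonzero: "t \<noteq> 0"
proof
  \<comment> \<open>The coefficient vector with a single 1 at index 1 would then give the sum
    zero.\<close>
  assume "t = 0"
  then have "(\<Sum>i<p. (if i = 1 then 1 else 0) ^ p * t ^ i) = 0"
    by (intro sum.neutral) (auto simp: frob_0)
  from expansion_0[OF this p_gt_1] show False by simp
qed

text \<open>The derivation $t\,d/dt$.\<close>

definition theta :: "'f \<Rightarrow> 'f" where
  "theta f = (\<Sum>i<p. of_nat i * coord f i ^ p * t ^ i)"

lemma coord_theta: "i < p \<Longrightarrow> coord (theta f) i = of_nat i * coord f i"
  by (rule coord_unique) (simp_all add: theta_def power_mult_distrib frob_of_nat)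

lemma theta_add: "theta (f + g) = theta f + theta g"
  by (simp add: theta_def coord_add frob_add algebra_simps sum.distrib)

lemma theta_frob_mult: "theta (a ^ p * f) = a ^ p * theta f"
  unfolding theta_def sum_distrib_left
  by (intro sum.cong refl, subst coord_frob_mult) (auto simp: power_mult_distrib mult_ac)

lemma theta_t_power: "theta (t ^ n) = of_nat n * t ^ n"
proof -
  have "theta (t ^ n) = (\<Sum>i<p. if i = n mod p then of_nat i * ((t ^ (n div p)) ^ p * t ^ i) else 0)"
    unfolding theta_def by (intro sum.cong) (auto simp: coord_power frob_0 mult.assoc)
  also have "\<dots> = of_nat (n mod p) * ((t ^ (n div p)) ^ p * t ^ (n mod p))"
    using p_pos by simp
  also have "(t ^ (n div p)) ^ p * t ^ (n mod p) = t ^ n"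
    by (metis div_mult_mod_eq power_add power_mult)
  also have "of_nat (n mod p) = (of_nat n :: 'f)"
    by (metis CHAR_eq of_nat_CHAR add.left_neutral div_mult_mod_eq mult_zero_right of_nat_add of_nat_mult)
  finally show ?thesis .
qed

lemma theta_0: "theta 0 = 0"
  using theta_frob_mult[of 0 0] by (simp add: frob_0)

lemma theta_sum: "theta (sum f A) = (\<Sum>i\<in>A. theta (f i))"
  by (induction A rule: infinite_finite_induct) (auto simp: theta_0 theta_add)

lemma theta_frob: "theta (a ^ p) = 0"
  using theta_frob_mult[of a 1] theta_t_power[of 0] by simp

text \<open>The product expands into monomials a^p t^(i+j) whose exponents may reach
  \<open>p\<close>. \<open>theta_t_power\<close> covers these too, because exponents matter only
  modulo p, and the factor i + j splits into the two Leibniz terms.\<close>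

lemma theta_mult: "theta (f * g) = f * theta g + g * theta f"
proof -
  let ?m = "\<lambda>i j. (coord f i * coord g j) ^ p * t ^ (i + j)"
  have "f * g = (\<Sum>i<p. coord f i ^ p * t ^ i) * (\<Sum>j<p. coord g j ^ p * t ^ j)"
    by (simp only: coord_expansion)
  also have "\<dots> = (\<Sum>i<p. \<Sum>j<p. ?m i j)"
    by (simp add: sum_product power_mult_distrib power_add mult_ac)
  finally have "theta (f * g) = (\<Sum>i<p. \<Sum>j<p. of_nat (i + j) * ?m i j)"
    by (simp only: theta_sum theta_frob_mult theta_t_power) (simp only: mult_ac)
  also have "\<dots> = (\<Sum>i<p. \<Sum>j<p. of_nat j * ?m i j) + (\<Sum>i<p. \<Sum>j<p. of_nat i * ?m i j)"
    by (simp add: algebra_simps sum.distrib)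
  also have "(\<Sum>i<p. \<Sum>j<p. of_nat j * ?m i j) = (\<Sum>i<p. coord f i ^ p * t ^ i) * theta g"
    unfolding theta_def sum_product
    by (intro sum.cong refl) (simp add: power_mult_distrib power_add mult_ac)
  also have "(\<Sum>i<p. \<Sum>j<p. of_nat i * ?m i j) = theta f * (\<Sum>j<p. coord g j ^ p * t ^ j)"
    unfolding theta_def sum_product
    by (intro sum.cong refl) (simp add: power_mult_distrib power_add mult_ac)
  finally show ?thesis by (simp only: coord_expansion) (simp only: mult.commute)
qed

lemma theta_power: "theta (f ^ Suc n) = of_nat (Suc n) * f ^ n * theta f"
  by (induction n) (auto simp: theta_mult algebra_simps)

text \<open>
  In terms of the coordinate $w$ of the form $w\,dt/t$, this is the Cartier operator.
\<close>

definition kappa :: "'f \<Rightarrow> 'f" where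
  "kappa w = coord w 0"

lemma kappa_add: "kappa (f + g) = kappa f + kappa g"
  by (simp add: kappa_def coord_add p_pos)

lemma kappa_frob_mult: "kappa (a ^ p * f) = a * kappa f"
  by (simp add: kappa_def coord_frob_mult p_pos)

text \<open>\<open>theta f\<close> is the coordinate of df, so this is the vanishing of the Cartier
  operator on exact forms: \<open>theta\<close> multiplies the coordinate 0 by 0.\<close>

lemma kappa_theta: "kappa (theta f) = 0"
  by (simp add: kappa_def coord_theta p_pos)

lemma kappa_1: "kappa 1 = 1"
  using coord_power[of 0 0] p_pos by (simp add: kappa_def)

lemma kappa_frob: "kappa (a ^ p) = a"
  using kappa_frob_mult[of a 1] kappa_1 by simp

lemma kappa_0: "kappa 0 = 0"
  using kappa_frob_mult[of 0 0] by (simp add: frob_0)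

lemma kappa_sum: "kappa (sum f A) = (\<Sum>i\<in>A. kappa (f i))"
  by (induction A rule: infinite_finite_induct) (auto simp: kappa_0 kappa_add)

text \<open>
  Since $\frac1p\bigl((x+y)^p - x^p - y^p\bigr)$ has integral coefficients,
  $(x+y)^{p-1} d(x+y) - x^{p-1}dx - y^{p-1}dy$ is exact.
\<close>

lemma kappa_power_theta_add:
  "kappa ((x + y) ^ (p - 1) * theta (x + y)) =
   kappa (x ^ (p - 1) * theta x) + kappa (y ^ (p - 1) * theta y)"
proof -
  obtain n where n: "p = Suc n"
    using p_pos by (cases p) auto
  let ?b = "\<lambda>k. of_nat (n choose k) :: 'f"
  define m where "m k = ?b k * x ^ k * y ^ (n - k)" for k
  \<comment> \<open>This is ((x+y)^p - x^p - y^p) / p with k = j + 1, where (p choose k) / p is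
    rewritten as (p-1 choose j) / (j+1). The denominators j + 1 < p are invertible in F.\<close>
  define Q where "Q = (\<Sum>j<n. ?b j / of_nat (Suc j) * (x ^ Suc j * y ^ (n - j)))"
  have binom: "(x + y) ^ n = (\<Sum>k\<le>n. m k)"
    by (simp add: binomial_ring m_def)
  have trm: "theta (?b j / of_nat (Suc j) * (x ^ Suc j * y ^ (n - j)))
      = m j * theta x + m (Suc j) * theta y" if "j < n" for j
  proof -
    have nz: "of_nat (Suc j) \<noteq> (0 :: 'f)"
      using that n by (intro of_nat_neq_0) auto
    \<comment> \<open>The factor lies in the prime field, so it equals its own p-th power and is a
      constant of the derivation.\<close>
    have const: "theta (?b j / of_nat (Suc j) * f) = ?b j / of_nat (Suc j) * theta f" for f
      using theta_frob_mult[of "?b j / of_nat (Suc j)" f]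
      by (simp add: power_divide frob_of_nat del: of_nat_Suc)
    define i where "i = n - Suc j"
    have i: "n - j = Suc i" "n - Suc j = i"
      using that by (auto simp: i_def)
    have "Suc j * (n choose Suc j) = (n - j) * (n choose j)"
      by (metis binomial_absorb_comp binomial_absorption)
    then have "of_nat (Suc j) * ?b (Suc j) = of_nat (n - j) * ?b j"
      by (metis of_nat_mult)
    then have bb: "?b j * of_nat (Suc i) / of_nat (Suc j) = ?b (Suc j)"
      using nz i by (simp add: field_simps del: of_nat_Suc)
    have "theta (?b j / of_nat (Suc j) * (x ^ Suc j * y ^ Suc i))
        = ?b j / of_nat (Suc j) * (x ^ Suc j * (of_nat (Suc i) * y ^ i * theta y)
          + y ^ Suc i * (of_nat (Suc j) * x ^ j * theta x))"
      unfolding const theta_mult[of "x ^ Suc j"] theta_power ..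
    also have "\<dots> = ?b j * x ^ j * y ^ Suc i * theta x
        + ?b j * of_nat (Suc i) / of_nat (Suc j) * x ^ Suc j * y ^ i * theta y"
      using nz by (simp add: field_simps del: of_nat_Suc)
    finally show ?thesis
      unfolding bb by (simp only: m_def i)
  qed
  have "theta Q = (\<Sum>j<n. m j) * theta x + (\<Sum>j<n. m (Suc j)) * theta y"
    unfolding Q_def theta_sum sum_distrib_right sum.distrib[symmetric]
    by (intro sum.cong refl trm) simp
  \<comment> \<open>The two partial sums of the binomial expansion miss the top term x^n and the
    bottom term y^n; these are the corrections in the additivity formula.\<close>
  also have "(\<Sum>j<n. m j) = (x + y) ^ n - x ^ n"
    unfolding binom by (simp add: lessThan_Suc_atMost[symmetric] m_def)
  also have "(\<Sum>j<n. m (Suc j)) = (x + y) ^ n - y ^ n"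
    unfolding binom by (simp add: sum.atMost_shift m_def)
  finally have "(x + y) ^ n * theta (x + y) = theta Q + (x ^ n * theta x + y ^ n * theta y)"
    by (simp add: theta_add algebra_simps)
  then have "kappa ((x + y) ^ n * theta (x + y)) = kappa (x ^ n * theta x) + kappa (y ^ n * theta y)"
    by (simp only: kappa_add kappa_theta add_0_left)
  moreover have "p - 1 = n"
    using n by simp
  ultimately show ?thesis
    by (simp only:)
qed

text \<open>In terms of forms, C(x^(p-1) dx) = dx. For a monomial z = c^p t^i one has theta z = i z,
  and z^(p-1) times i z is the p-th power of i z. The general case follows because both sides are
  additive in x.\<close>

lemma kappa_power_theta: "kappa (x ^ (p - 1) * theta x) = theta x"
proof -
  have mono: "kappa (z ^ (p - 1) * theta z) = theta z" if z: "z = c ^ p * t ^ i" for z c i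
  proof -
    have "theta z = of_nat i * z"
      by (simp add: z theta_frob_mult theta_t_power)
    moreover have "z ^ (p - 1) * (of_nat i * z) = (of_nat i * z) ^ p"
    proof -
      have "z ^ (p - 1) * (of_nat i * z) = of_nat i * (z ^ (p - 1) * z)"
        by (simp only: mult_ac)
      also have "z ^ (p - 1) * z = z ^ p"
        using p_pos by (rule power_minus_mult)
      finally show ?thesis
        by (simp add: power_mult_distrib frob_of_nat)
    qed
    ultimately show ?thesis
      by (simp only: kappa_frob)
  qed
  have "kappa (sum g A ^ (p - 1) * theta (sum g A)) = theta (sum g A)"
    if "finite A" "\<And>i. i \<in> A \<Longrightarrow> kappa (g i ^ (p - 1) * theta (g i)) = theta (g i)"
    for A :: "nat set" and g
    using that
  proof (induction A rule: finite_induct)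
    case (insert i A)
    then show ?case
      using kappa_power_theta_add[of "g i" "sum g A"] by (simp add: theta_add)
  qed (simp add: theta_0 kappa_0)
  from this[of "{..<p}" "\<lambda>i. coord x i ^ p * t ^ i"] show ?thesis
    using mono by (simp add: coord_expansion)
qed

text \<open>The terms with i < p - 1 are exact, because x^i dx = d(x^(i+1)) / (i+1); the top term is
  \<open>kappa_power_theta\<close>. This shows that all presentations in \<open>cartier\<close> give
  the same image.\<close>

lemma kappa_form: "kappa ((\<Sum>i<p. f i ^ p * x ^ i) * theta x) = f (p - 1) * theta x"
proof -
  obtain n where n: "p = Suc n"
    using p_pos by (cases p) auto
  have exact: "kappa (f i ^ p * x ^ i * theta x) = 0" if "i < n" for i
  proof -
    have nz: "of_nat (Suc i) \<noteq> (0 :: 'f)"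
      using that n by (intro of_nat_neq_0) auto
    have "f i ^ p * x ^ i * theta x = (f i / of_nat (Suc i)) ^ p * theta (x ^ Suc i)"
      using nz unfolding theta_power power_divide frob_of_nat by (simp add: field_simps)
    then show ?thesis
      by (simp only: kappa_frob_mult kappa_theta mult_zero_right)
  qed
  have "{..<p} = insert n {..<n}"
    using n by auto
  then have "kappa ((\<Sum>i<p. f i ^ p * x ^ i) * theta x)
      = (\<Sum>i\<in>insert n {..<n}. kappa (f i ^ p * x ^ i * theta x))"
    by (simp only: sum_distrib_right kappa_sum)
  also have "\<dots> = kappa (f n ^ p * (x ^ n * theta x))"
    by (simp add: exact) (simp only: mult.assoc)
  also have "\<dots> = f n * theta x"
    using kappa_power_theta[of x] by (simp only: kappa_frob_mult) (simp add: n)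
  finally show ?thesis by (simp add: n)
qed

end

text \<open>Chain rule: the coefficients of an expansion in powers of \<open>t\<close> are p-th
  powers and hence constants for the derivation of \<open>s\<close>, which is thus determined by its
  value at \<open>t\<close>.\<close>

lemma theta_change_of_basis:
  assumes "p_basis p s" and "p_basis p t"
  shows "p_basis.theta p s f = p_basis.theta p s t / t * p_basis.theta p t f"
proof -
  interpret S: p_basis p s by fact
  interpret T: p_basis p t by fact
  have pow: "S.theta (t ^ i) = of_nat i * t ^ i * (S.theta t / t)" for i
    using T.t_nonzero S.theta_power[of t "i - 1"] S.theta_frob[of 1]
    by (cases i) auto
  have "S.theta f = S.theta (\<Sum>i<p. T.coord f i ^ p * t ^ i)"
    by (simp add: T.coord_expansion)
  also have "\<dots> = (\<Sum>i<p. T.coord f i ^ p * (of_nat i * t ^ i * (S.theta t / t)))"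
    by (simp only: S.theta_sum S.theta_frob_mult pow)
  also have "\<dots> = S.theta t / t * T.theta f"
    by (simp add: T.theta_def sum_distrib_left mult_ac)
  finally show ?thesis .
qed


section \<open>Valuations and Kaehler differentials\<close>

locale valued =
  fixes emb :: "'k::field \<Rightarrow> 'f::field" and v :: "'f \<Rightarrow> int"
  assumes place: "place emb v"
begin

lemma v_0: "v 0 = 0"
  and v_mult: "f \<noteq> 0 \<Longrightarrow> g \<noteq> 0 \<Longrightarrow> v (f * g) = v f + v g"
  and v_add: "f \<noteq> 0 \<Longrightarrow> g \<noteq> 0 \<Longrightarrow> f + g \<noteq> 0 \<Longrightarrow> v (f + g) \<ge> min (v f) (v g)"
  and v_emb: "v (emb a) = 0"
  and v_uniformizer: "\<exists>t. v t = 1"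
  using place unfolding place_def by auto

lemma v_1: "v 1 = 0"
  using v_mult[of 1 1] by simp

lemma v_minus: "v (- f) = v f"
proof (cases "f = 0")
  case False
  have "v (- 1) = 0"
    using v_mult[of "- 1" "- 1"] v_1 by simp
  then show ?thesis
    using v_mult[of "- 1" f] False by simp
qed simp

lemma v_power: "f \<noteq> 0 \<Longrightarrow> v (f ^ n) = int n * v f"
  by (induction n) (auto simp: v_1 v_mult algebra_simps)

lemma v_inverse: "v (inverse f) = - v f"
  by (cases "f = 0") (use v_mult[of f "inverse f"] v_1 v_0 in auto)

lemma v_divide: "f \<noteq> 0 \<Longrightarrow> g \<noteq> 0 \<Longrightarrow> v (f / g) = v f - v g"
  by (simp add: divide_inverse v_mult v_inverse)

lemma v_power_int: "f \<noteq> 0 \<Longrightarrow> v (f powi n) = n * v f"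
  by (cases n rule: int_cases3) (auto simp: v_1 v_power power_int_minus v_inverse)

lemma v_add_less:
  assumes "f \<noteq> 0" "g \<noteq> 0" "v f < v g"
  shows "f + g \<noteq> 0" "v (f + g) = v f"
proof -
  show nz: "f + g \<noteq> 0"
  proof
    assume "f + g = 0"
    then have "f = - g" by (simp add: eq_neg_iff_add_eq_0)
    with v_minus[of g] assms show False by simp
  qed
  \<comment> \<open>Writing f as (f + g) - g bounds v (f + g) from above, because v g exceeds v
    f.\<close>
  have "v f \<ge> min (v (f + g)) (v (- g))"
    using v_add[of "f + g" "- g"] nz assms by simp
  moreover have "v (f + g) \<ge> min (v f) (v g)"
    using nz assms by (intro v_add) auto
  ultimately show "v (f + g) = v f"
    using assms v_minus[of g] by linarith
qed

lemma v_sum_inj: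
  assumes "finite I" "I \<noteq> {}" "\<And>i. i \<in> I \<Longrightarrow> g i \<noteq> 0" "inj_on (\<lambda>i. v (g i)) I"
  shows "sum g I \<noteq> 0 \<and> (\<exists>i\<in>I. v (sum g I) = v (g i)) \<and> (\<forall>i\<in>I. v (sum g I) \<le> v (g i))"
  using assms
proof (induction I rule: finite_ne_induct)
  case (insert i I)
  then have IH: "sum g I \<noteq> 0" "\<exists>i\<in>I. v (sum g I) = v (g i)" "\<forall>i\<in>I. v (sum g I) \<le> v (g i)"
    by auto
  have gi: "g i \<noteq> 0" and ne: "v (g i) \<noteq> v (sum g I)"
    using insert IH(2) by auto
  have s: "sum g (insert i I) = g i + sum g I"
    using insert by simp
  consider "v (g i) < v (sum g I)" | "v (sum g I) < v (g i)"
    using ne by linarith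
  then show ?case
  proof cases
    case 1
    from v_add_less[OF gi IH(1) 1] 1 IH show ?thesis
      unfolding s by force
  next
    case 2
    from v_add_less[OF IH(1) gi 2] 2 IH show ?thesis
      unfolding s by (auto simp: add.commute)
  qed
qed auto

lemma val_ge_0: "val_ge v 0 n"
  by (simp add: val_ge_def)

lemma val_ge_emb: "val_ge v (emb a) 0"
  by (simp add: val_ge_def v_emb)

lemma val_ge_mono: "val_ge v f n \<Longrightarrow> m \<le> n \<Longrightarrow> val_ge v f m"
  by (auto simp: val_ge_def)

lemma val_ge_add: "val_ge v f n \<Longrightarrow> val_ge v g n \<Longrightarrow> val_ge v (f + g) n"
  using v_add[of f g] by (cases "f = 0"; cases "g = 0"; cases "f + g = 0") (auto simp: val_ge_def)

lemma val_ge_minus: "val_ge v (- f) n \<longleftrightarrow> val_ge v f n"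
  by (simp add: val_ge_def v_minus)

lemma val_ge_diff: "val_ge v f n \<Longrightarrow> val_ge v g n \<Longrightarrow> val_ge v (f - g) n"
  using val_ge_add[of f n "- g"] by (simp add: val_ge_minus)

lemma val_ge_mult: "val_ge v f m \<Longrightarrow> val_ge v g n \<Longrightarrow> val_ge v (f * g) (m + n)"
  by (cases "f = 0"; cases "g = 0") (auto simp: val_ge_def v_mult)

lemma val_ge_sum: "(\<And>i. i \<in> A \<Longrightarrow> val_ge v (f i) n) \<Longrightarrow> val_ge v (sum f A) n"
  by (induction A rule: infinite_finite_induct) (auto simp: val_ge_0 val_ge_add)

lemma val_ge_power: "val_ge v f 0 \<Longrightarrow> val_ge v (f ^ n) 0"
  by (cases "f = 0"; cases "n = 0") (auto simp: val_ge_def v_power v_1)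

text \<open>The nonzero terms have valuations p v(c_i) + i, which are distinct modulo p, so nothing
  cancels. This yields both the independence of the powers of \<open>t\<close> over F^p and bounds
  for the coordinates.\<close>

lemma v_expansion:
  fixes p :: nat
  assumes t: "v t = 1" and "i < p" "c i \<noteq> 0"
  shows "(\<Sum>i<p. c i ^ p * t ^ i) \<noteq> 0"
    and "\<exists>i<p. c i \<noteq> 0 \<and> v (\<Sum>i<p. c i ^ p * t ^ i) = int p * v (c i) + int i"
    and "\<forall>i<p. c i \<noteq> 0 \<longrightarrow> v (\<Sum>i<p. c i ^ p * t ^ i) \<le> int p * v (c i) + int i"
proof -
  let ?s = "\<Sum>i<p. c i ^ p * t ^ i"
  define I where "I = {i. i < p \<and> c i \<noteq> 0}"
  have t0: "t \<noteq> 0"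
    using t v_0 by auto
  have vt: "v (c i ^ p * t ^ i) = int p * v (c i) + int i" if "i \<in> I" for i
    using that t t0 by (simp add: I_def v_mult v_power)
  have "inj_on (\<lambda>i. v (c i ^ p * t ^ i)) I"
  proof (rule inj_onI)
    fix i j assume ij: "i \<in> I" "j \<in> I" and eq: "v (c i ^ p * t ^ i) = v (c j ^ p * t ^ j)"
    then have "int p * v (c i) + int i = int p * v (c j) + int j"
      using vt by metis
    then have "(int p * v (c i) + int i) mod int p = (int p * v (c j) + int j) mod int p"
      by simp
    then show "i = j"
      using ij by (simp add: I_def)
  qed
  moreover have "finite I" "I \<noteq> {}" "\<And>i. i \<in> I \<Longrightarrow> c i ^ p * t ^ i \<noteq> 0"
    using assms t0 by (auto simp: I_def)
  moreover have s: "(\<Sum>i\<in>I. c i ^ p * t ^ i) = ?s"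
    using assms(2) by (intro sum.mono_neutral_left) (auto simp: I_def zero_power)
  ultimately have "?s \<noteq> 0 \<and> (\<exists>i\<in>I. v ?s = v (c i ^ p * t ^ i)) \<and> (\<forall>i\<in>I. v ?s \<le> v (c i ^ p * t ^ i))"
    using v_sum_inj[of I "\<lambda>i. c i ^ p * t ^ i"] by simp
  then show "?s \<noteq> 0" "\<exists>i<p. c i \<noteq> 0 \<and> v ?s = int p * v (c i) + int i"
    "\<forall>i<p. c i \<noteq> 0 \<longrightarrow> v ?s \<le> int p * v (c i) + int i"
    using vt by (auto simp: I_def)
qed

end

section \<open>Function fields over a finite constant field\<close>

locale curve = prime_char p "TYPE('f)" for p :: nat and emb :: "'k::{field,finite} \<Rightarrow> 'f::field" +
  assumes function_field: "function_field_of_curve emb"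
begin

lemma emb_1: "emb 1 = 1"
  and emb_add: "emb (a + b) = emb a + emb b"
  and emb_mult: "emb (a * b) = emb a * emb b"
  using function_field by (auto simp: function_field_of_curve_def field_embedding_def)

lemma emb_diff: "emb (a - b) = emb a - emb b"
  using emb_add[of "a - b" b] by simp

lemma emb_0: "emb 0 = 0"
  using emb_diff[of 0 0] by simp

lemma emb_power: "emb (a ^ n) = emb a ^ n"
  by (induction n) (auto simp: emb_1 emb_mult)

lemma emb_eq_0_iff: "emb a = 0 \<longleftrightarrow> a = 0"
proof
  assume "emb a = 0"
  then have "emb (a * inverse a) = 0"
    by (simp add: emb_mult)
  then show "a = 0"
    using emb_1 by (cases "a = 0") auto
qed (simp add: emb_0)

lemma emb_inj: "emb a = emb b \<longleftrightarrow> a = b"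
  using emb_eq_0_iff[of "a - b"] by (simp add: emb_diff)

text \<open>Finite fields are perfect. The characteristic is known for F, so injectivity of the
  Frobenius is pulled back along \<open>emb\<close>; finiteness turns it into surjectivity.\<close>

lemma emb_pth_root: "\<exists>b. emb a = emb b ^ p"
proof -
  have "inj (\<lambda>b::'k. b ^ p)"
  proof (rule injI)
    fix a b :: 'k assume "a ^ p = b ^ p"
    then have "emb a ^ p = emb b ^ p"
      by (simp flip: emb_power)
    then show "a = b"
      by (simp add: frob_inj emb_inj)
  qed
  then have "surj (\<lambda>b::'k. b ^ p)"
    by (rule finite_UNIV_inj_surj[OF finite_class.finite_UNIV])
  then obtain b where "a = b ^ p"
    by (rule surjE)
  then show ?thesis
    by (auto simp: emb_power)
qed

text \<open>For E = K(x) the field E^p(x) contains x and, as K is perfect, also K; hence it contains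
  all of E.\<close>

lemma adjoin_subset_frob_span: "adjoin emb x \<subseteq> frob_span (adjoin emb x) x"
proof (rule adjoin_minimal)
  let ?E = "adjoin emb x"
  note mono = frob_span_monomial[OF is_subfield_adjoin[of emb x] adjoin_gen]
  show "is_subfield (frob_span ?E x)"
    by (rule is_subfield_frob_span[OF is_subfield_adjoin adjoin_gen])
  show "x \<in> frob_span ?E x"
    using mono[OF is_subfieldD(2)[OF is_subfield_adjoin], of 1] by simp
  show "range emb \<subseteq> frob_span ?E x"
  proof
    fix y assume "y \<in> range emb"
    then obtain b where "y = emb b ^ p"
      using emb_pth_root by blast
    then show "y \<in> frob_span ?E x"
      using mono[OF adjoin_emb[of emb b x], of 0] by simp
  qed
qed

end

locale curve_basis = curve p emb + p_basis p t
  for p :: nat and emb :: "'k::{field,finite} \<Rightarrow> 'f::field" and t :: 'f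

text \<open>Independence over F^p comes from valuations modulo p. For spanning, the p powers of
  \<open>t\<close> together with f are p + 1 elements, hence dependent, and by independence the
  coefficient of f is not zero.\<close>

lemma (in curve) curve_basis_uniformizer:
  assumes "place emb v" and t: "v t = 1"
  shows "curve_basis p emb t"
proof -
  interpret valued emb v by (rule valued.intro) fact
  have indep: "c i = 0" if "(\<Sum>i<p. c i ^ p * t ^ i) = 0" "i < p" for c i
    using v_expansion(1)[of t i p c] that t by auto
  obtain x where fin: "finite_over (adjoin emb x)"
    using function_field by (auto simp: function_field_of_curve_def)
  have "\<exists>c. f = (\<Sum>i<p. c i ^ p * t ^ i)" for f
  proof -
    define y where "y i = (if i < p then t ^ i else f)" for i
    obtain c where c: "\<exists>i\<le>p. c i \<noteq> 0" "(\<Sum>i\<le>p. c i ^ p * y i) = 0"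
      using frob_dependence[OF is_subfield_adjoin fin adjoin_subset_frob_span] by blast
    have eq: "(\<Sum>i<p. c i ^ p * t ^ i) + c p ^ p * f = 0"
      using c(2) by (simp add: y_def flip: lessThan_Suc_atMost)
    have "c p \<noteq> 0"
    proof
      assume "c p = 0"
      then show False
        using c(1) indep[of c] eq by (auto simp: frob_0 le_less)
    qed
    have "f = - (\<Sum>i<p. c i ^ p * t ^ i) / c p ^ p"
      using eq \<open>c p \<noteq> 0\<close> by (simp add: field_simps eq_neg_iff_add_eq_0)
    also have "\<dots> = (\<Sum>i<p. (- (c i / c p)) ^ p * t ^ i)"
      by (simp add: frob_minus power_divide sum_negf sum_divide_distrib)
    finally show ?thesis
      by (rule exI[of _ "\<lambda>i. - (c i / c p)"])
  qed
  with indep show ?thesis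
    by unfold_locales
qed

section \<open>The Kaehler differentials as a one-dimensional space over F\<close>

context curve_basis
begin

text \<open>The map u dx to u theta(x) on the free module, before the relations are divided
  out.\<close>

definition pairing :: "('f \<Rightarrow>\<^sub>0 'f) \<Rightarrow> 'f" where
  "pairing s = (\<Sum>x\<in>Poly_Mapping.keys s. Poly_Mapping.lookup s x * theta x)"

lemma pairing_add: "pairing (r + s) = pairing r + pairing s"
  unfolding pairing_def by (rule setsum_keys_plus_distrib) (auto simp: distrib_right)

lemma pairing_0: "pairing 0 = 0"
  by (simp add: pairing_def)

lemma pairing_diff: "pairing (r - s) = pairing r - pairing s"
  using pairing_add[of "r - s" s] by simp

lemma pairing_single: "pairing (Poly_Mapping.single x u) = u * theta x"
  by (simp add: pairing_def)

lemma pairing_scale: "pairing (Poly_Mapping.map ((*) c) s) = c * pairing s"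
proof -
  have l: "Poly_Mapping.lookup (Poly_Mapping.map ((*) c) s) x = c * Poly_Mapping.lookup s x" for x
    by (simp add: Poly_Mapping.map.rep_eq when_def)
  then have "pairing (Poly_Mapping.map ((*) c) s)
      = (\<Sum>x\<in>Poly_Mapping.keys s. c * Poly_Mapping.lookup s x * theta x)"
    unfolding pairing_def by (intro sum.mono_neutral_cong_left) (auto simp: in_keys_iff)
  then show ?thesis
    by (simp add: pairing_def sum_distrib_left mult.assoc)
qed

lemma theta_emb: "theta (emb a) = 0"
  using emb_pth_root[of a] by (auto simp: theta_frob)

text \<open>The scalar action is the one in \<open>kaehler_rel\<close>, so the span rules obtained
  here apply to the submodule divided out there.\<close>

sublocale scale: module "\<lambda>c::'f. Poly_Mapping.map ((*) c) :: ('f \<Rightarrow>\<^sub>0 'f) \<Rightarrow> _"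
  by unfold_locales
    (auto simp: mult_map_scale_conv_mult distrib_left distrib_right single_add mult_single
      simp flip: mult.assoc)

abbreviation rels :: "('f \<Rightarrow>\<^sub>0 'f) set" where
  "rels \<equiv> scale.span (kaehler_generators emb)"

lemma pairing_rels: "s \<in> rels \<Longrightarrow> pairing s = 0"
proof (induction s rule: scale.span_induct_alt)
  case (step c x y)
  have "pairing x = 0"
    using step(1) unfolding kaehler_generators_def
    by (auto simp: pairing_diff pairing_single theta_add theta_mult theta_emb)
  with step show ?case
    by (simp add: pairing_add pairing_scale)
qed (rule pairing_0)

lemma single_sum: "Poly_Mapping.single x (sum f A) = (\<Sum>i\<in>A. Poly_Mapping.single x (f i))"
  by (induction A rule: infinite_finite_induct) (auto simp: single_add)

lemma rels_scale_generator:
  assumes "g \<in> kaehler_generators emb"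
  shows "Poly_Mapping.map ((*) u) g \<in> rels"
  by (intro scale.span_scale scale.span_base assms)

lemma rels_add:
  "Poly_Mapping.single (f + g) u - (Poly_Mapping.single f u + Poly_Mapping.single g u) \<in> rels"
proof -
  have "Poly_Mapping.single (f + g) 1 - Poly_Mapping.single f 1 - Poly_Mapping.single g 1
      \<in> kaehler_generators emb"
    by (auto simp: kaehler_generators_def)
  from rels_scale_generator[OF this, of u] show ?thesis
    by (simp add: scale.scale_right_diff_distrib scale.scale_right_distrib diff_diff_eq)
qed

lemma rels_mult:
  "Poly_Mapping.single (f * g) u - (Poly_Mapping.single g (u * f) + Poly_Mapping.single f (u * g))
    \<in> rels"
proof -
  have "Poly_Mapping.single (f * g) 1 - Poly_Mapping.single g f - Poly_Mapping.single f g
      \<in> kaehler_generators emb"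
    by (auto simp: kaehler_generators_def)
  from rels_scale_generator[OF this, of u] show ?thesis
    by (simp add: scale.scale_right_diff_distrib scale.scale_right_distrib diff_diff_eq)
qed

lemma rels_emb: "Poly_Mapping.single (emb a) u \<in> rels"
proof -
  have "Poly_Mapping.single (emb a) 1 \<in> kaehler_generators emb"
    by (auto simp: kaehler_generators_def)
  from rels_scale_generator[OF this, of u] show ?thesis
    by simp
qed

lemma rels_power:
  "Poly_Mapping.single (f ^ Suc n) u - Poly_Mapping.single f (of_nat (Suc n) * u * f ^ n) \<in> rels"
proof (induction n arbitrary: u)
  case (Suc n)
  from scale.span_add[OF rels_mult[of f "f ^ Suc n" u] Suc[of "u * f"]]
  have "Poly_Mapping.single (f ^ Suc (Suc n)) u
      - (Poly_Mapping.single f (of_nat (Suc n) * (u * f) * f ^ n)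
         + Poly_Mapping.single f (u * f ^ Suc n)) \<in> rels"
    by (simp add: algebra_simps)
  also have "Poly_Mapping.single f (of_nat (Suc n) * (u * f) * f ^ n)
         + Poly_Mapping.single f (u * f ^ Suc n)
      = Poly_Mapping.single f (of_nat (Suc (Suc n)) * u * f ^ Suc n)"
    by (simp add: algebra_simps flip: single_add)
  finally show ?case .
qed (simp add: scale.span_zero)

text \<open>d(a^p) = p a^(p-1) da, and p = 0 in F.\<close>

lemma rels_frob: "Poly_Mapping.single (a ^ p) u \<in> rels"
  using rels_power[of a "p - 1" u] p_pos of_nat_p by simp

lemma rels_sum:
  "finite A \<Longrightarrow> Poly_Mapping.single (sum f A) u - (\<Sum>i\<in>A. Poly_Mapping.single (f i) u) \<in> rels"
proof (induction A rule: finite_induct)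
  case empty
  then show ?case
    using rels_emb[of 0 u] by (simp add: emb_0)
next
  case (insert i A)
  from scale.span_add[OF rels_add[of "f i" "sum f A" u] insert.IH] insert.hyps show ?case
    by (simp add: algebra_simps)
qed

text \<open>The differential i a^p t^(i-1) dt, written with t^i / t so that i = 0 needs no separate
  formula.\<close>

lemma rels_monomial:
  "Poly_Mapping.single (a ^ p * t ^ i) u
    - Poly_Mapping.single t (u * (of_nat i * a ^ p * t ^ i) / t) \<in> rels"
proof (cases i)
  case 0
  then show ?thesis
    using rels_frob[of a u] by simp
next
  case (Suc n)
  have "(Poly_Mapping.single (a ^ p * t ^ i) u
      - (Poly_Mapping.single (t ^ i) (u * a ^ p) + Poly_Mapping.single (a ^ p) (u * t ^ i)))
      + Poly_Mapping.single (a ^ p) (u * t ^ i)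
      + (Poly_Mapping.single (t ^ i) (u * a ^ p)
         - Poly_Mapping.single t (of_nat (Suc n) * (u * a ^ p) * t ^ n)) \<in> rels"
    unfolding Suc by (intro scale.span_add rels_mult rels_frob rels_power)
  then show ?thesis
    using t_nonzero by (simp add: Suc mult_ac)
qed

lemma rels_single:
  "Poly_Mapping.single x u - Poly_Mapping.single t (u * theta x / t) \<in> rels"
proof -
  have "(Poly_Mapping.single (\<Sum>i<p. coord x i ^ p * t ^ i) u
      - (\<Sum>i<p. Poly_Mapping.single (coord x i ^ p * t ^ i) u))
      + (\<Sum>i<p. Poly_Mapping.single (coord x i ^ p * t ^ i) u
          - Poly_Mapping.single t (u * (of_nat i * coord x i ^ p * t ^ i) / t)) \<in> rels"
    by (intro scale.span_add scale.span_sum rels_sum rels_monomial) auto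
  then show ?thesis
    by (simp add: coord_expansion theta_def sum_subtractf sum_distrib_left sum_divide_distrib
        flip: single_sum)
qed

lemma poly_mapping_sum_single:
  "(\<Sum>x\<in>Poly_Mapping.keys s. Poly_Mapping.single x (Poly_Mapping.lookup s x)) = (s :: 'f \<Rightarrow>\<^sub>0 'f)"
proof (rule poly_mapping_eqI)
  fix k
  show "Poly_Mapping.lookup
      (\<Sum>x\<in>Poly_Mapping.keys s. Poly_Mapping.single x (Poly_Mapping.lookup s x)) k
    = Poly_Mapping.lookup s k"
    by (simp add: lookup_sum lookup_single when_def in_keys_iff)
qed

text \<open>Modulo the relations everything is a multiple of dt. Hence an element with pairing zero
  is a relation, which is the converse of \<open>pairing_rels\<close>.\<close>

lemma rels_normal_form: "s - Poly_Mapping.single t (pairing s / t) \<in> rels"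
proof -
  have "(\<Sum>x\<in>Poly_Mapping.keys s. Poly_Mapping.single x (Poly_Mapping.lookup s x)
      - Poly_Mapping.single t (Poly_Mapping.lookup s x * theta x / t)) \<in> rels"
    by (intro scale.span_sum rels_single)
  then show ?thesis
    by (simp add: sum_subtractf poly_mapping_sum_single pairing_def sum_divide_distrib
        flip: single_sum)
qed

lemma kaehler_rel_iff: "(r, s) \<in> kaehler_rel emb \<longleftrightarrow> pairing r = pairing s"
proof
  assume "(r, s) \<in> kaehler_rel emb"
  then show "pairing r = pairing s"
    using pairing_rels[of "s - r"] by (simp add: kaehler_rel_def pairing_diff)
next
  assume "pairing r = pairing s"
  then have "pairing (s - r) = 0"
    by (simp add: pairing_diff)
  then have "s - r \<in> rels"
    using rels_normal_form[of "s - r"] by simp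
  then show "(r, s) \<in> kaehler_rel emb"
    by (simp add: kaehler_rel_def)
qed

text \<open>The form $w\,dt/t$.\<close>

definition log_form :: "'f \<Rightarrow> 'f form" where
  "log_form w = {s. pairing s = w}"

lemma form_eq_log_form: "form emb u x = log_form (u * theta x)"
  by (auto simp: form_def log_form_def kaehler_rel_iff pairing_single)

lemma theta_t: "theta t = t"
  using theta_t_power[of 1] by simp

lemma form_t: "form emb u t = log_form (u * t)"
  by (simp add: form_eq_log_form theta_t)

lemma log_form_eq: "log_form w = form emb (w / t) t"
  using t_nonzero by (simp add: form_t)

lemma log_form_inj: "log_form w = log_form w' \<longleftrightarrow> w = w'"
proof
  assume "log_form w = log_form w'"
  moreover have "Poly_Mapping.single t (w / t) \<in> log_form w"
    using t_nonzero by (simp add: log_form_def pairing_single theta_t)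
  ultimately show "w = w'"
    using t_nonzero by (simp add: log_form_def pairing_single theta_t)
qed simp

lemma zero_form_eq: "zero_form emb = log_form 0"
  by (auto simp: zero_form_def log_form_def kaehler_rel_iff pairing_0)

lemma forms_eq: "forms emb = range log_form"
proof -
  have "kaehler_rel emb `` {s} = log_form (pairing s)" for s
    by (auto simp: log_form_def kaehler_rel_iff)
  moreover have "w = pairing (Poly_Mapping.single t (w / t))" for w
    using t_nonzero by (simp add: pairing_single theta_t)
  ultimately show ?thesis
    unfolding forms_def quotient_def by (auto simp del: range_eqI) (metis)
qed

end


section \<open>Uniformizers are separating\<close>

text \<open>A spanning family may repeat elements, whereas \<open>finite_over\<close> asks for a
  set; the coefficients of equal members are added up.\<close>

lemma finite_over_family:
  assumes E: "is_subfield E" and "finite I"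
    and span: "\<And>y. \<exists>c. (\<forall>i\<in>I. c i \<in> E) \<and> y = (\<Sum>i\<in>I. c i * g i)"
  shows "finite_over E"
  unfolding finite_over_def
proof (intro exI[of _ "g ` I"] conjI allI)
  show "finite (g ` I)"
    using assms by simp
  fix y
  obtain c where c: "\<forall>i\<in>I. c i \<in> E" "y = (\<Sum>i\<in>I. c i * g i)"
    using span by blast
  have "y = (\<Sum>b\<in>g ` I. \<Sum>i\<in>{i \<in> I. g i = b}. c i * g i)"
    unfolding c(2) by (rule sum.image_gen[OF assms(2)])
  then have "y = (\<Sum>b\<in>g ` I. (\<Sum>i\<in>{i \<in> I. g i = b}. c i) * b)"
    by (simp add: sum_distrib_right)
  then show "\<exists>c. (\<forall>b\<in>g ` I. c b \<in> E) \<and> y = (\<Sum>b\<in>g ` I. c b * b)"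
    using c(1)
    by (intro exI[of _ "\<lambda>b. \<Sum>i\<in>{i \<in> I. g i = b}. c i"]) (auto intro: is_subfield_sum[OF E])
qed

lemma powers_dependent:
  assumes E: "is_subfield E" and "finite B"
    and span: "\<And>i. \<exists>c. (\<forall>b\<in>B. c b \<in> E) \<and> y ^ i = (\<Sum>b\<in>B. c b * g b)"
  shows "\<exists>n d. (\<forall>i. d i \<in> E) \<and> (\<exists>i\<le>n. d i \<noteq> 0) \<and> (\<Sum>i\<le>n. d i * y ^ i) = 0"
proof -
  have "\<forall>i. \<exists>c. (\<forall>b\<in>B. c b \<in> E) \<and> y ^ i = (\<Sum>b\<in>B. c b * g b)"
    using span by blast
  then obtain c where "\<forall>i. (\<forall>b\<in>B. c i b \<in> E) \<and> y ^ i = (\<Sum>b\<in>B. c i b * g b)"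
    by (rule choice[THEN exE])
  then have "\<exists>d. (\<forall>i. d i \<in> E) \<and> (\<exists>i\<in>{..card B}. d i \<noteq> 0) \<and> (\<Sum>i\<in>{..card B}. d i * y ^ i) = 0"
    by (intro linear_dependence_over_subfield[OF E \<open>finite B\<close>, of "{..card B}" c _ g]) auto
  then show ?thesis
    by auto
qed

text \<open>A ring that is finite over a field and has no zero divisors is a field. In a relation
  between the powers of s the lowest power can be cancelled, which gives s times an element of
  \<open>R\<close> equal to a nonzero constant of \<open>E\<close>.\<close>

lemma is_subfield_finite_extension_ring:
  assumes E: "is_subfield E" and "E \<subseteq> R" and "finite B"
    and diff: "\<And>a b. a \<in> R \<Longrightarrow> b \<in> R \<Longrightarrow> a - b \<in> R"
    and mult: "\<And>a b. a \<in> R \<Longrightarrow> b \<in> R \<Longrightarrow> a * b \<in> R"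
    and span: "\<And>a. a \<in> R \<Longrightarrow> \<exists>c. (\<forall>b\<in>B. c b \<in> E) \<and> a = (\<Sum>b\<in>B. c b * g b)"
  shows "is_subfield R"
proof -
  have zero: "0 \<in> R" and one: "1 \<in> R"
    using is_subfieldD(1,2)[OF E] assms(2) by auto
  have minus: "- a \<in> R" if "a \<in> R" for a
    using diff[OF zero that] by simp
  have add: "a + b \<in> R" if "a \<in> R" "b \<in> R" for a b
    using diff[OF that(1) minus[OF that(2)]] by simp
  have sum: "sum f A \<in> R" if "\<And>i. i \<in> A \<Longrightarrow> f i \<in> R" for f and A :: "nat set"
    using that by (induction A rule: infinite_finite_induct) (auto intro: zero add)
  have pow: "s ^ n \<in> R" if "s \<in> R" for s n
    by (induction n) (auto intro: one mult that)
  have "inverse s \<in> R" if s: "s \<in> R" for s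
  proof (cases "s = 0")
    case False
    obtain n d where d: "\<And>i. d i \<in> E" "\<exists>i\<le>n. d i \<noteq> 0" "(\<Sum>i\<le>n. d i * s ^ i) = 0"
      using powers_dependent[OF E \<open>finite B\<close> span[OF pow[OF s]]] by blast
    define k where "k = (LEAST i. d i \<noteq> 0)"
    have k: "d k \<noteq> 0" "\<And>i. i < k \<Longrightarrow> d i = 0"
      using d(2) LeastI_ex[of "\<lambda>i. d i \<noteq> 0"] not_less_Least[of _ "\<lambda>i. d i \<noteq> 0"]
      unfolding k_def by blast+
    have kn: "k \<le> n"
      using d(2) k(2) by (meson not_le_imp_less order_trans not_less)
    have "0 = (\<Sum>i\<in>{k..n}. d i * s ^ i)"
      unfolding d(3)[symmetric] by (rule sum.mono_neutral_right) (auto simp: k(2))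
    also have "\<dots> = d k * s ^ k + (\<Sum>i\<in>{Suc k..n}. d i * s ^ i)"
      using kn by (simp add: sum.atLeast_Suc_atMost)
    also have "(\<Sum>i\<in>{Suc k..n}. d i * s ^ i)
        = s ^ k * (s * (\<Sum>i\<in>{Suc k..n}. d i * s ^ (i - Suc k)))"
      unfolding sum_distrib_left
    proof (intro sum.cong refl)
      fix i assume "i \<in> {Suc k..n}"
      then have "s ^ i = s ^ k * s * s ^ (i - Suc k)"
        by (metis atLeastAtMost_iff le_add_diff_inverse power_Suc2 power_add)
      then show "d i * s ^ i = s ^ k * (s * (d i * s ^ (i - Suc k)))"
        by simp
    qed
    finally have "s ^ k * (d k + s * (\<Sum>i\<in>{Suc k..n}. d i * s ^ (i - Suc k))) = 0"
      by (simp add: algebra_simps)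
    then have "d k + s * (\<Sum>i\<in>{Suc k..n}. d i * s ^ (i - Suc k)) = 0"
      using False by simp
    then have "s * (\<Sum>i\<in>{Suc k..n}. d i * s ^ (i - Suc k)) = - d k"
      by (simp add: eq_neg_iff_add_eq_0 add.commute)
    then have "inverse s = - (inverse (d k) * (\<Sum>i\<in>{Suc k..n}. d i * s ^ (i - Suc k)))"
      using False k(1) by (simp add: field_simps)
    moreover have "inverse (d k) \<in> R" "\<And>i. d i \<in> R"
      using d(1) is_subfieldD(5)[OF E] assms(2) by auto
    ultimately show ?thesis
      by (auto intro!: minus mult sum pow s)
  qed (simp add: zero)
  with zero one diff mult show ?thesis
    by (auto simp: is_subfield_def)
qed

text \<open>Long division only divides by the leading coefficient of \<open>g\<close>, so quotient
  and remainder keep their coefficients in \<open>E\<close>.\<close>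

lemma poly_division_over_subfield:
  assumes E: "is_subfield E" and g: "g \<noteq> 0" "\<And>i. coeff g i \<in> E"
    and "\<And>i. coeff f i \<in> E"
  shows "\<exists>q r. (\<forall>i. coeff q i \<in> E) \<and> (\<forall>i. coeff r i \<in> E) \<and> f = q * g + r \<and>
    (r = 0 \<or> degree r < degree g)"
  using assms(4)
\<comment> \<open>The shifted degree distinguishes zero from nonzero constants, so the step from a
  constant to zero is also a decrease.\<close>
proof (induction "if f = 0 then 0 else Suc (degree f)" arbitrary: f rule: less_induct)
  case less
  show ?case
  proof (cases "f = 0 \<or> degree f < degree g")
    case True
    then show ?thesis
      using less.prems is_subfieldD(1)[OF E] by (intro exI[of _ 0] exI[of _ f]) auto
  next
    case False
    define m where "m = monom (lead_coeff f / lead_coeff g) (degree f - degree g)"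
    define f' where "f' = f - m * g"
    have m: "coeff m i \<in> E" for i
      using less.prems g(2) is_subfieldD[OF E] by (auto simp: m_def)
    have mg: "coeff (m * g) i \<in> E" for i
      unfolding coeff_mult using m g(2) by (intro is_subfield_sum[OF E] is_subfieldD(4)[OF E])
    have f': "coeff f' i \<in> E" for i
      unfolding f'_def coeff_diff using mg less.prems by (intro is_subfieldD(3)[OF E])
    have "lead_coeff f / lead_coeff g \<noteq> 0"
      using False g(1) by simp
    then have "degree m = degree f - degree g" "m \<noteq> 0"
      unfolding m_def by (rule degree_monom_eq, simp add: monom_eq_0_iff)
    then have deg: "degree (m * g) = degree f"
      using False g(1) by (simp add: degree_mult_eq)
    have "lead_coeff (m * g) = lead_coeff f"
      unfolding lead_coeff_mult m_def lead_coeff_monom using g(1) by simp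
    then have "coeff f' (degree f) = 0"
      using deg by (simp add: f'_def)
    moreover have "degree f' \<le> degree f"
      unfolding f'_def using deg by (intro degree_diff_le) auto
    ultimately have "f' = 0 \<or> degree f' < degree f"
      by (metis le_neq_implies_less leading_coeff_0_iff)
    then have "(if f' = 0 then 0 else Suc (degree f')) < (if f = 0 then 0 else Suc (degree f))"
      using False by auto
    from less.hyps[OF this f'] obtain q r where qr: "\<forall>i. coeff q i \<in> E" "\<forall>i. coeff r i \<in> E"
      "f' = q * g + r" "r = 0 \<or> degree r < degree g"
      by blast
    have "f = (m + q) * g + r"
      using qr(3) by (simp add: f'_def algebra_simps)
    moreover have "\<forall>i. coeff (m + q) i \<in> E"
      using m qr(1) is_subfieldD(7)[OF E] by simp
    ultimately show ?thesis
      using qr by blast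
  qed
qed

text \<open>
  The Euclidean algorithm for \<open>h\<close> and \<open>f\<close> stays in $E[X]$, and by minimality of \<open>h\<close> no
  remainder vanishes before a constant is reached.
\<close>

lemma coprime_minimal_annihilator:
  assumes E: "is_subfield E" and h: "\<And>i. coeff h i \<in> E" "h \<noteq> 0" "poly h y = 0"
    and min: "\<And>g. (\<And>i. coeff g i \<in> E) \<Longrightarrow> g \<noteq> 0 \<Longrightarrow> poly g y = 0 \<Longrightarrow> degree h \<le> degree g"
    and "\<And>i. coeff f i \<in> E" "f \<noteq> 0" "degree f < degree h"
  shows "coprime h f"
  using assms(6-8)
proof (induction "degree f" arbitrary: f rule: less_induct)
  case less
  show ?case
  proof (cases "degree f = 0")
    case True
    then have "is_unit f"
      using less.prems by (simp add: is_unit_iff_degree)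
    then show ?thesis
      by (rule is_unit_right_imp_coprime)
  next
    case False
    obtain q r where qr: "\<forall>i. coeff q i \<in> E" "\<forall>i. coeff r i \<in> E" "h = q * f + r"
      "r = 0 \<or> degree r < degree f"
      using poly_division_over_subfield[OF E less.prems(2,1) h(1)] by blast
    have fy: "poly f y \<noteq> 0"
      using min[of f] less.prems by auto
    \<comment> \<open>Otherwise h = q f with f(y) nonzero, and q would annihilate y in smaller
      degree.\<close>
    have "r \<noteq> 0"
    proof
      assume "r = 0"
      then have hq: "h = q * f"
        using qr by simp
      then have "poly q y = 0" "q \<noteq> 0"
        using h fy by auto
      with min[of q] qr(1) have "degree h \<le> degree q"
        by auto
      moreover have "degree h = degree q + degree f"
        unfolding hq using \<open>q \<noteq> 0\<close> less.prems(2) by (rule degree_mult_eq)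
      ultimately show False
        using False by simp
    qed
    then have "coprime h r"
      using less.hyps[of r] less.prems qr by auto
    show ?thesis
    proof (rule coprimeI)
      fix d assume d: "d dvd h" "d dvd f"
      moreover have "r = h - q * f"
        using qr by simp
      ultimately have "d dvd r"
        by simp
      with d \<open>coprime h r\<close> show "is_unit d"
        by (auto dest: coprime_common_divisor)
    qed
  qed
qed

section \<open>Rational function fields K(x) and exchange of the generator\<close>

context curve
begin

abbreviation eval_at :: "'f \<Rightarrow> 'k poly \<Rightarrow> 'f" where
  "eval_at x h \<equiv> poly (map_poly emb h) x"

lemma eval_at_pCons: "eval_at x (pCons a h) = emb a + x * eval_at x h"
  by (simp add: map_poly_pCons emb_0)

lemma eval_at_add: "eval_at x (g + h) = eval_at x g + eval_at x h"
proof -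
  have "map_poly emb (g + h) = map_poly emb g + map_poly emb h"
    by (intro poly_eqI) (simp add: coeff_map_poly emb_0 emb_add)
  then show ?thesis by simp
qed

lemma eval_at_diff: "eval_at x (g - h) = eval_at x g - eval_at x h"
  using eval_at_add[of "g - h" h x] by simp

lemma eval_at_smult: "eval_at x (smult a h) = emb a * eval_at x h"
proof -
  have "map_poly emb (smult a h) = smult (emb a) (map_poly emb h)"
    by (intro poly_eqI) (simp add: coeff_map_poly emb_0 emb_mult)
  then show ?thesis by simp
qed

lemma eval_at_mult: "eval_at x (g * h) = eval_at x g * eval_at x h"
  by (induction g)
    (simp_all add: eval_at_add eval_at_smult eval_at_pCons emb_0 algebra_simps)

lemma eval_at_1: "eval_at x 1 = 1"
  by (simp add: one_pCons eval_at_pCons emb_1)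

lemma eval_at_prod: "eval_at x (prod f A) = (\<Prod>i\<in>A. eval_at x (f i))"
  by (induction A rule: infinite_finite_induct) (auto simp: eval_at_1 eval_at_mult)

lemma eval_at_eq_sum: "degree h \<le> n \<Longrightarrow> eval_at x h = (\<Sum>i\<le>n. emb (coeff h i) * x ^ i)"
proof -
  assume "degree h \<le> n"
  then have "(\<Sum>i\<le>degree (map_poly emb h). coeff (map_poly emb h) i * x ^ i)
      = (\<Sum>i\<le>n. coeff (map_poly emb h) i * x ^ i)"
    by (intro sum.mono_neutral_left)
      (auto simp: coeff_eq_0 intro: order_trans[OF _ order_trans[OF map_poly_degree_leq]])
  then show ?thesis
    by (simp add: poly_altdef coeff_map_poly emb_0)
qed

text \<open>The fractions of polynomial values form a subfield containing K and x, so K(x) is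
  contained in it.\<close>

lemma adjoin_fraction:
  assumes "y \<in> adjoin emb x"
  shows "\<exists>g h. eval_at x h \<noteq> 0 \<and> y = eval_at x g / eval_at x h"
proof -
  define S where "S = {y. \<exists>g h. eval_at x h \<noteq> 0 \<and> y = eval_at x g / eval_at x h}"
  have SI: "eval_at x g / eval_at x h \<in> S" if "eval_at x h \<noteq> 0" for g h
    using that by (auto simp: S_def)
  have S1: "eval_at x g \<in> S" for g
    using SI[of 1 g] by (simp add: eval_at_1)
  have "is_subfield S"
    unfolding is_subfield_def
  proof (intro conjI ballI)
    show "0 \<in> S" "1 \<in> S"
      using S1[of 0] S1[of 1] by (auto simp: eval_at_1)
    fix a b assume "a \<in> S" "b \<in> S"
    then obtain g h g' h' where eqs: "eval_at x h \<noteq> 0" "a = eval_at x g / eval_at x h"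
      "eval_at x h' \<noteq> 0" "b = eval_at x g' / eval_at x h'"
      by (auto simp: S_def)
    have "a - b = eval_at x (g * h' - g' * h) / eval_at x (h * h')"
      "a * b = eval_at x (g * g') / eval_at x (h * h')"
      unfolding eqs(2,4) eval_at_mult eval_at_diff using eqs(1,3) by (simp_all add: field_simps)
    moreover have "eval_at x (h * h') \<noteq> 0"
      using eqs(1,3) by (simp add: eval_at_mult)
    ultimately show "a - b \<in> S" "a * b \<in> S"
      using SI[of "h * h'"] by metis+
  next
    fix a assume "a \<in> S"
    then obtain g h where eqs: "eval_at x h \<noteq> 0" "a = eval_at x g / eval_at x h"
      by (auto simp: S_def)
    show "inverse a \<in> S"
      using eqs SI[of g h] S1[of 0] by (cases "eval_at x g = 0") auto
  qed
  moreover have "emb a \<in> S" for a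
    using S1[of "[:a:]"] by (simp add: eval_at_pCons)
  moreover have "x \<in> S"
    using S1[of "[:0, 1:]"] by (simp add: eval_at_pCons emb_0 emb_1)
  ultimately have "adjoin emb x \<subseteq> S"
    by (intro adjoin_minimal) auto
  with assms show ?thesis
    by (auto simp: S_def)
qed

text \<open>
  The element \<open>t\<close> is algebraic over $K(x)$; a polynomial relation between \<open>x\<close> and \<open>t\<close>
  also makes \<open>x\<close> algebraic over $K(t)$, because \<open>t\<close> is transcendental.
\<close>

lemma finite_over_adjoin_exchange:
  assumes fin: "finite_over (adjoin emb x)" and t: "transcendental emb t"
  shows "finite_over (adjoin emb t)"
proof -
  note Ex = is_subfield_adjoin[of emb x] and Et = is_subfield_adjoin[of emb t]
  obtain B where B: "finite B"
    "\<And>y. \<exists>c. (\<forall>b\<in>B. c b \<in> adjoin emb x) \<and> y = (\<Sum>b\<in>B. c b * b)"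
    using fin unfolding finite_over_def by blast
  obtain n d where d: "\<And>i. d i \<in> adjoin emb x" "\<exists>i\<le>n. d i \<noteq> 0" "(\<Sum>i\<le>n. d i * t ^ i) = 0"
    using powers_dependent[OF Ex B(1,2), of t] by blast
  have "\<forall>i. \<exists>g h. eval_at x h \<noteq> 0 \<and> d i = eval_at x g / eval_at x h"
    using d(1) adjoin_fraction by blast
  then obtain g h where gh: "\<And>i. eval_at x (h i) \<noteq> 0"
    "\<And>i. d i = eval_at x (g i) / eval_at x (h i)"
    by metis
  \<comment> \<open>\<open>H\<close> is a common denominator of the relation for \<open>t\<close>,
    and the \<open>a i\<close> are the cleared coefficients, polynomials in x over K.\<close>
  define H where "H = (\<Prod>i\<le>n. h i)"
  define a where "a i = g i * (\<Prod>j\<in>{..n} - {i}. h j)" for i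
  have H: "eval_at x H \<noteq> 0"
    using gh(1) by (simp add: H_def eval_at_prod)
  have a: "eval_at x (a i) = d i * eval_at x H" if "i \<le> n" for i
  proof -
    have "eval_at x H = eval_at x (h i) * (\<Prod>j\<in>{..n} - {i}. eval_at x (h j))"
      unfolding H_def eval_at_prod using that by (intro prod.remove) auto
    then show ?thesis
      using gh[of i] by (simp add: a_def eval_at_mult eval_at_prod)
  qed
  define N where "N = Max ((\<lambda>i. degree (a i)) ` {..n})"
  have N: "degree (a i) \<le> N" if "i \<le> n" for i
    using that unfolding N_def by (intro Max_ge) auto
  \<comment> \<open>The same relation arranged by powers of x; its coefficients now are polynomials
    in \<open>t\<close>.\<close>
  define e where "e j = (\<Sum>i\<le>n. emb (coeff (a i) j) * t ^ i)" for j
  have "(\<Sum>j\<le>N. e j * x ^ j) = (\<Sum>i\<le>n. (\<Sum>j\<le>N. emb (coeff (a i) j) * x ^ j) * t ^ i)"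
    unfolding e_def sum_distrib_right by (subst sum.swap) (simp add: mult_ac)
  also have "\<dots> = (\<Sum>i\<le>n. d i * eval_at x H * t ^ i)"
    using N a by (intro sum.cong refl) (simp add: eval_at_eq_sum[symmetric])
  also have "\<dots> = eval_at x H * (\<Sum>i\<le>n. d i * t ^ i)"
    by (simp add: sum_distrib_left mult_ac)
  finally have rel: "(\<Sum>j\<le>N. e j * x ^ j) = 0"
    by (simp add: d(3))
  have eE: "e j \<in> adjoin emb t" for j
    unfolding e_def
    by (intro is_subfield_sum[OF Et] is_subfieldD(4)[OF Et] is_subfield_power[OF Et]
        adjoin_emb adjoin_gen)
  have ex: "\<exists>j\<le>N. e j \<noteq> 0"
  proof -
    obtain i where i: "i \<le> n" "d i \<noteq> 0"
      using d(2) by blast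
    then have "a i \<noteq> 0"
      using a[of i] H by auto
    \<comment> \<open>At this power of x the coefficient \<open>e j\<close> is the value at
      \<open>t\<close> of a polynomial \<open>q\<close> containing the leading coefficient of
      \<open>a i\<close>. It does not vanish, as \<open>t\<close> is transcendental.\<close>
    define j where "j = degree (a i)"
    define q where "q = (\<Sum>k\<le>n. monom (coeff (a k) j) k)"
    have cq: "coeff q k = (if k \<le> n then coeff (a k) j else 0)" for k
      by (simp add: q_def coeff_sum)
    have "coeff q i \<noteq> 0"
      using i \<open>a i \<noteq> 0\<close> by (simp add: cq j_def)
    then have "q \<noteq> 0"
      by auto
    then have "eval_at t q \<noteq> 0"
      using t unfolding transcendental_def by blast
    moreover have "eval_at t q = e j"
    proof -
      have "degree q \<le> n"
        by (rule degree_le) (auto simp: cq)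
      then show ?thesis
        by (subst eval_at_eq_sum) (auto simp: cq e_def)
    qed
    ultimately show ?thesis
      using N[OF i(1)] by (auto simp: j_def)
  qed
  define m where "m = Max {j. j \<le> N \<and> e j \<noteq> 0}"
  have "m \<in> {j. j \<le> N \<and> e j \<noteq> 0}"
    unfolding m_def using ex by (intro Max_in) auto
  then have m: "m \<le> N" "e m \<noteq> 0"
    by auto
  have m_max: "e j = 0" if "j \<le> N" "m < j" for j
    using that Max_ge[of "{j. j \<le> N \<and> e j \<noteq> 0}" j] unfolding m_def by fastforce
  have "(\<Sum>j\<le>N. e j * x ^ j) = (\<Sum>j\<le>m. e j * x ^ j)"
    using m m_max by (intro sum.mono_neutral_right) auto
  with rel have rel': "(\<Sum>j<m. e j * x ^ j) + e m * x ^ m = 0"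
    by (simp flip: lessThan_Suc_atMost)
  have "m \<noteq> 0"
    using rel' m(2) by (cases m) auto
  have "x ^ m = - (\<Sum>j<m. e j * x ^ j) / e m"
    using rel' m(2) by (simp add: field_simps eq_neg_iff_add_eq_0)
  then have xm: "x ^ m = (\<Sum>j<m. - (e j / e m) * x ^ j)"
    by (simp add: sum_negf sum_divide_distrib)
  \<comment> \<open>The span of 1, ..., x^(m-1) over K(t). Because x^m lies in it, it is a ring;
    being finite over K(t), it is a field and contains K(x).\<close>
  define S where "S = {\<Sum>j<m. c j * x ^ j |c. \<forall>j. c j \<in> adjoin emb t}"
  have S_I: "(\<Sum>j<m. c j * x ^ j) \<in> S" if "\<And>j. c j \<in> adjoin emb t" for c
    using that by (auto simp: S_def)
  have S_add: "y + z \<in> S" if yz: "y \<in> S" "z \<in> S" for y z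
  proof -
    obtain c c' where "\<forall>j. c j \<in> adjoin emb t" "\<forall>j. c' j \<in> adjoin emb t"
      "y = (\<Sum>j<m. c j * x ^ j)" "z = (\<Sum>j<m. c' j * x ^ j)"
      using yz unfolding S_def by blast
    then show ?thesis
      using S_I[of "\<lambda>j. c j + c' j"] is_subfieldD(7)[OF Et]
      by (simp add: distrib_right sum.distrib)
  qed
  have S_scale: "r * y \<in> S" if yz: "r \<in> adjoin emb t" "y \<in> S" for r y
  proof -
    obtain c where "\<forall>j. c j \<in> adjoin emb t" "y = (\<Sum>j<m. c j * x ^ j)"
      using yz unfolding S_def by blast
    then show ?thesis
      using S_I[of "\<lambda>j. r * c j"] is_subfieldD(4)[OF Et that(1)]
      by (simp add: sum_distrib_left mult.assoc)
  qed
  have S_0: "0 \<in> S"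
    using S_I[of "\<lambda>_. 0"] is_subfieldD(1)[OF Et] by simp
  have S_sum: "sum f A \<in> S" if "\<And>i. i \<in> A \<Longrightarrow> f i \<in> S" for f and A :: "nat set"
    using that by (induction A rule: infinite_finite_induct) (auto intro: S_0 S_add)
  have x_pow: "x ^ j \<in> S" if "j \<le> m" for j
  proof (cases "j = m")
    case True
    have "- (e j / e m) \<in> adjoin emb t" for j
      using eE is_subfieldD(6,8)[OF Et] by auto
    then show ?thesis
      unfolding True xm by (rule S_I)
  next
    case False
    then have "(\<Sum>i<m. (if i = j then 1 else 0) * x ^ i) = x ^ j"
      using that by (simp add: if_distrib[of "\<lambda>c. c * _"] cong: if_cong)
    then show ?thesis
      using S_I[of "\<lambda>i. if i = j then 1 else 0"] is_subfieldD(1,2)[OF Et] by simp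
  qed
  have x_mult: "x * y \<in> S" if yz: "y \<in> S" for y
  proof -
    obtain c where c: "\<forall>j. c j \<in> adjoin emb t" "y = (\<Sum>j<m. c j * x ^ j)"
      using yz unfolding S_def by blast
    have "x * y = (\<Sum>j<m. c j * x ^ Suc j)"
      by (simp add: c(2) sum_distrib_left mult_ac)
    also have "\<dots> \<in> S"
      using c(1) by (intro S_sum S_scale x_pow) auto
    finally show ?thesis .
  qed
  have S_mult: "y * z \<in> S" if yz: "y \<in> S" "z \<in> S" for y z
  proof -
    obtain c where c: "\<forall>j. c j \<in> adjoin emb t" "y = (\<Sum>j<m. c j * x ^ j)"
      using yz unfolding S_def by blast
    have "x ^ j * z \<in> S" for j
      by (induction j) (auto simp: mult.assoc intro: x_mult that)
    with c(1) have "c j * (x ^ j * z) \<in> S" for j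
      by (intro S_scale[of "c j" "x ^ j * z"]) auto
    then have "(\<Sum>j<m. c j * (x ^ j * z)) \<in> S"
      by (rule S_sum)
    then show ?thesis
      by (simp add: c(2) sum_distrib_right mult.assoc)
  qed
  have S_E: "adjoin emb t \<subseteq> S"
    using S_scale x_pow[of 0] by fastforce
  have S_diff: "y - z \<in> S" if "y \<in> S" "z \<in> S" for y z
  proof -
    have "- 1 \<in> adjoin emb t"
      using is_subfieldD(2,6)[OF Et] by blast
    from S_add[OF that(1) S_scale[OF this that(2)]] show ?thesis
      by simp
  qed
  have "is_subfield S"
  proof (rule is_subfield_finite_extension_ring[OF Et S_E, of "{..<m}" "\<lambda>j. x ^ j"])
    fix a assume "a \<in> S"
    then show "\<exists>c. (\<forall>b\<in>{..<m}. c b \<in> adjoin emb t) \<and> a = (\<Sum>b<m. c b * x ^ b)"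
      by (auto simp: S_def)
  qed (auto intro: S_diff S_mult)
  moreover have "x \<in> S"
    using x_pow[of 1] \<open>m \<noteq> 0\<close> by simp
  moreover have "range emb \<subseteq> S"
    using S_E adjoin_emb[of emb _ t] by blast
  ultimately have xS: "adjoin emb x \<subseteq> S"
    by (intro adjoin_minimal)
  \<comment> \<open>Tower of extensions: the products of elements of \<open>B\<close> with powers
    x^j, j < m, span F over K(t).\<close>
  show ?thesis
  proof (rule finite_over_family[OF Et, of "B \<times> {..<m}" "\<lambda>bj. x ^ snd bj * fst bj"])
    fix y
    obtain c where c: "\<forall>b\<in>B. c b \<in> adjoin emb x" "y = (\<Sum>b\<in>B. c b * b)"
      using B(2) by blast
    have "\<forall>b\<in>B. \<exists>c'. (\<forall>j. c' j \<in> adjoin emb t) \<and> c b = (\<Sum>j<m. c' j * x ^ j)"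
      using c(1) xS unfolding S_def by blast
    then obtain c' where c': "\<forall>b\<in>B. (\<forall>j. c' b j \<in> adjoin emb t) \<and> c b = (\<Sum>j<m. c' b j * x ^ j)"
      by metis
    have "y = (\<Sum>b\<in>B. \<Sum>j<m. c' b j * (x ^ j * b))"
      unfolding c(2) using c' by (intro sum.cong refl) (simp add: sum_distrib_right mult.assoc)
    also have "\<dots> = (\<Sum>bj\<in>B \<times> {..<m}. c' (fst bj) (snd bj) * (x ^ snd bj * fst bj))"
      by (simp add: sum.cartesian_product case_prod_beta)
    finally show "\<exists>c. (\<forall>i\<in>B \<times> {..<m}. c i \<in> adjoin emb t)
        \<and> y = (\<Sum>bj\<in>B \<times> {..<m}. c bj * (x ^ snd bj * fst bj))"
      using c' by (intro exI[of _ "\<lambda>bj. c' (fst bj) (snd bj)"]) auto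
  qed (use B in auto)
qed

text \<open>In a relation h(t) = 0, after cancelling powers of \<open>t\<close>, a nonzero constant
  of valuation 0 would equal a multiple of \<open>t\<close>.\<close>

lemma transcendental_uniformizer:
  assumes "place emb v" and t: "v t = 1"
  shows "transcendental emb t"
proof -
  interpret valued emb v by (rule valued.intro) fact
  have t1: "val_ge v t 1"
    using t by (simp add: val_ge_def)
  have int: "val_ge v (eval_at t h) 0" for h
  proof (induction h)
    case (pCons a h)
    have "val_ge v (t * eval_at t h) 0"
      using val_ge_mult[OF t1 pCons.IH] by (rule val_ge_mono) simp
    then show ?case
      unfolding eval_at_pCons by (intro val_ge_add val_ge_emb)
  qed (simp add: val_ge_0)
  have "h \<noteq> 0 \<Longrightarrow> eval_at t h \<noteq> 0" for h
  proof (induction h)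
    case (pCons a h)
    show ?case
    proof (cases "a = 0")
      case True
      then show ?thesis
        using pCons t v_0 by (auto simp: eval_at_pCons emb_0)
    next
      case False
      show ?thesis
      proof
        assume "eval_at t (pCons a h) = 0"
        then have "- emb a = t * eval_at t h"
          by (simp add: eval_at_pCons neg_eq_iff_add_eq_0)
        moreover have "val_ge v (t * eval_at t h) 1"
          using val_ge_mult[OF t1 int] by simp
        ultimately have "val_ge v (emb a) 1"
          by (metis val_ge_minus)
        then show False
          using False by (simp add: val_ge_def v_emb emb_eq_0_iff)
      qed
    qed
  qed simp
  then show ?thesis
    by (simp add: transcendental_def)
qed

end

text \<open>
  If the minimal polynomial of \<open>y\<close> over $E = K(t)$ were $g(X^p)$, then decomposing its
  coefficients along $E = \bigoplus_k E^p t^k$ would give \<open>p\<close> annihilating polynomials of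
  smaller degree.
\<close>

lemma (in curve_basis) separable_over_adjoin:
  assumes fin: "finite_over (adjoin emb t)"
  shows "separable_over (adjoin emb t) y"
proof -
  let ?E = "adjoin emb t"
  note E = is_subfield_adjoin[of emb t]
  define ann where "ann h \<longleftrightarrow> (\<forall>i. coeff h i \<in> ?E) \<and> h \<noteq> 0 \<and> poly h y = 0" for h
  obtain B where B: "finite B" "\<And>y. \<exists>c. (\<forall>b\<in>B. c b \<in> ?E) \<and> y = (\<Sum>b\<in>B. c b * b)"
    using fin unfolding finite_over_def by blast
  obtain n d where d: "\<And>i. d i \<in> ?E" "\<exists>i\<le>n. d i \<noteq> 0" "(\<Sum>i\<le>n. d i * y ^ i) = 0"
    using powers_dependent[OF E B(1,2), of y] by blast
  have "ann (\<Sum>i\<le>n. monom (d i) i)"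
  proof -
    have co: "coeff (\<Sum>i\<le>n. monom (d i) i) k = (if k \<le> n then d k else 0)" for k
      by (simp add: coeff_sum)
    moreover have "(\<Sum>i\<le>n. monom (d i) i) \<noteq> 0"
      using d(2) co by (metis coeff_0)
    ultimately show ?thesis
      using d is_subfieldD(1)[OF E] by (auto simp: ann_def poly_sum poly_monom)
  qed
  then obtain h where h: "ann h" and min: "\<And>g. ann g \<Longrightarrow> degree h \<le> degree g"
    using ex_has_least_nat[of ann _ degree] by blast
  have hE: "\<And>i. coeff h i \<in> ?E" and h0: "h \<noteq> 0" and hy: "poly h y = 0"
    using h by (auto simp: ann_def)
  have deg_pos: "0 < degree h"
    using h0 hy by (metis degree_eq_zeroE gr0I pCons_0_0 poly_const_conv)
  have "pderiv h \<noteq> 0"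
  proof
    assume pd: "pderiv h = 0"
    \<comment> \<open>A vanishing derivative leaves only exponents divisible by p, so h = g(X^p)
      with deg g = \<open>D\<close>.\<close>
    have dvd: "p dvd i" if "coeff h i \<noteq> 0" for i
    proof (cases i)
      case (Suc j)
      have "of_nat (Suc j) * coeff h (Suc j) = 0"
        using pd coeff_pderiv[of h j] by simp
      then have "of_nat i = (0::'f)"
        using that Suc by auto
      then show ?thesis
        using CHAR_eq of_nat_eq_0_iff_char_dvd[where 'a='f] by metis
    qed simp
    define D where "D = degree h div p"
    have "p dvd degree h"
      using h0 by (intro dvd) simp
    then have pD: "p * D = degree h"
      by (simp add: D_def)
    have D: "D < degree h"
      using deg_pos p_gt_1 by (simp add: D_def)
    let ?c = "\<lambda>j k. coord (coeff h (p * j)) k"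
    \<comment> \<open>Each coefficient has an expansion with coefficients in E, since E = E^p(t); by
      uniqueness this is its expansion in F.\<close>
    have cE: "?c j k \<in> ?E" if "k < p" for j k
    proof -
      have "coeff h (p * j) \<in> frob_span ?E t"
        using hE adjoin_subset_frob_span by blast
      then obtain e where "\<forall>k. e k \<in> ?E" "coeff h (p * j) = (\<Sum>k<p. e k ^ p * t ^ k)"
        by (auto simp: frob_span_def)
      with that show ?thesis
        using coord_unique by metis
    qed
    have "0 = (\<Sum>i\<le>degree h. coeff h i * y ^ i)"
      using hy by (simp add: poly_altdef)
    also have "\<dots> = (\<Sum>i\<in>(\<lambda>j. p * j) ` {..D}. coeff h i * y ^ i)"
    proof (rule sum.mono_neutral_right)
      show "(\<lambda>j. p * j) ` {..D} \<subseteq> {..degree h}"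
        using pD by (auto simp flip: pD)
      show "\<forall>i\<in>{..degree h} - (\<lambda>j. p * j) ` {..D}. coeff h i * y ^ i = 0"
      proof
        fix i assume i: "i \<in> {..degree h} - (\<lambda>j. p * j) ` {..D}"
        have "\<not> p dvd i"
        proof
          assume "p dvd i"
          then obtain j where "i = p * j" by blast
          then show False
            using i p_pos by (auto simp flip: pD)
        qed
        then show "coeff h i * y ^ i = 0"
          using dvd by auto
      qed
    qed simp
    also have "\<dots> = (\<Sum>j\<le>D. coeff h (p * j) * y ^ (p * j))"
      using p_pos by (subst sum.reindex) (auto simp: inj_on_def)
    also have "\<dots> = (\<Sum>j\<le>D. \<Sum>k<p. (?c j k * y ^ j) ^ p * t ^ k)"
    proof (intro sum.cong refl)
      fix j
      have "coeff h (p * j) * y ^ (p * j) = (\<Sum>k<p. ?c j k ^ p * t ^ k) * y ^ (p * j)"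
        by (simp only: coord_expansion)
      also have "\<dots> = (\<Sum>k<p. (?c j k * y ^ j) ^ p * t ^ k)"
        unfolding sum_distrib_right
        by (intro sum.cong refl) (simp add: power_mult_distrib mult_ac flip: power_mult)
      finally show "coeff h (p * j) * y ^ (p * j) = (\<Sum>k<p. (?c j k * y ^ j) ^ p * t ^ k)" .
    qed
    also have "\<dots> = (\<Sum>k<p. (\<Sum>j\<le>D. ?c j k * y ^ j) ^ p * t ^ k)"
      by (subst sum.swap) (simp add: frob_sum sum_distrib_right)
    \<comment> \<open>Independence of the powers of \<open>t\<close> over F^p splits the one
      relation into p relations of degree at most \<open>D\<close>.\<close>
    finally have zero: "(\<Sum>j\<le>D. ?c j k * y ^ j) = 0" if "k < p" for k
      using expansion_0[of "\<lambda>k. \<Sum>j\<le>D. ?c j k * y ^ j"] that by simp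
    \<comment> \<open>A nonzero top coefficient would give an annihilator of degree at most D < deg
      h. All of them vanish, and with them the leading coefficient of h.\<close>
    have "?c D k = 0" if k: "k < p" for k
    proof (rule ccontr)
      assume nz: "?c D k \<noteq> 0"
      define g where "g = (\<Sum>j\<le>D. monom (?c j k) j)"
      have cg: "coeff g j = (if j \<le> D then ?c j k else 0)" for j
        by (simp add: g_def coeff_sum)
      have "g \<noteq> 0"
        using nz cg[of D] by auto
      moreover have "poly g y = 0"
        using zero[OF k] by (simp add: g_def poly_sum poly_monom)
      ultimately have "ann g"
        using cE[OF k] is_subfieldD(1)[OF E] by (simp add: ann_def cg)
      moreover have "degree g \<le> D"
        by (rule degree_le) (auto simp: cg)
      ultimately show False
        using min[of g] D by simp
    qed
    then have "coeff h (p * D) = 0"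
      using coord_expansion[of "coeff h (p * D)"] by (simp add: frob_0)
    then show False
      using h0 by (simp add: pD)
  qed
  moreover have "degree (pderiv h) < degree h"
  proof -
    have "degree (pderiv h) \<le> degree h - 1"
      by (rule degree_le) (auto simp: coeff_pderiv coeff_eq_0)
    then show ?thesis
      using deg_pos by simp
  qed
  moreover have "of_nat k \<in> ?E" for k
    by (induction k) (auto intro: is_subfieldD[OF E])
  then have "coeff (pderiv h) i \<in> ?E" for i
    unfolding coeff_pderiv using hE by (intro is_subfieldD(4)[OF E])
  ultimately have "coprime h (pderiv h)"
    using coprime_minimal_annihilator[OF E hE h0 hy, of "pderiv h"] min
    by (auto simp: ann_def)
  then show ?thesis
    unfolding separable_over_def using hE hy by blast
qed

text \<open>Supplies the separating element that the description in \<open>cartier\<close> asks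
  for.\<close>

lemma (in curve) separating_uniformizer:
  assumes "place emb v" "v t = 1"
  shows "separating emb t"
proof -
  interpret curve_basis p emb t
    by (rule curve_basis_uniformizer) fact+
  have tr: "transcendental emb t"
    by (rule transcendental_uniformizer) fact+
  obtain x where "finite_over (adjoin emb x)"
    using function_field by (auto simp: function_field_of_curve_def)
  from finite_over_adjoin_exchange[OF this tr] tr separable_over_adjoin show ?thesis
    by (simp add: separating_def)
qed


section \<open>Residues and codes\<close>

locale curve_place = curve_basis p emb t + valued emb v
  for p :: nat and emb :: "'k::{field,finite} \<Rightarrow> 'f::field" and t :: 'f and v :: "'f \<Rightarrow> int" +
  assumes v_t: "v t = 1"

lemma (in curve) curve_place_uniformizer:
  assumes "place emb v" "v t = 1"
  shows "curve_place p emb t v"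
  by (intro curve_place.intro curve_place_axioms.intro valued.intro
      curve_basis_uniformizer[OF assms] assms)

context curve_place
begin

lemma v_coord:
  assumes "w \<noteq> 0" "i < p" "coord w i \<noteq> 0"
  shows "v w \<le> int p * v (coord w i) + int i"
  using v_expansion(3)[of t i p "coord w", OF v_t assms(2,3)] assms(2,3)
  unfolding coord_expansion by blast

text \<open>From 0 <= p v(c_i) + i and i < p it follows that v(c_i) > -1.\<close>

lemma val_ge_coord:
  assumes "val_ge v w 0" "i < p"
  shows "val_ge v (coord w i) 0"
proof (cases "coord w i = 0")
  case False
  then have "w \<noteq> 0"
    using coord_frob_mult[of i 0 w] assms(2) by (auto simp: frob_0)
  with v_coord[OF _ assms(2) False] assms have "0 \<le> int p * v (coord w i) + int i"
    by (auto simp: val_ge_def)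
  then have "- int p < int p * v (coord w i)"
    using assms(2) by linarith
  then have "int p * (- 1) < int p * v (coord w i)"
    by simp
  then have "- 1 < v (coord w i)"
    using p_pos by (simp only: mult_less_cancel_left_pos of_nat_0_less_iff)
  then show ?thesis
    by (simp add: val_ge_def)
qed (simp add: val_ge_0)

lemma val_ge_t_power: "val_ge v (t ^ i) (int i)"
  using t_nonzero v_t by (simp add: val_ge_def v_power)

lemma val_ge_kappa: "val_ge v w 0 \<Longrightarrow> val_ge v (kappa w) 0"
  using val_ge_coord[of w 0] p_pos by (simp add: kappa_def)

text \<open>The coordinates of w have no pole, and every term of the expansion except the first
  carries a factor \<open>t\<close>.\<close>

lemma val_ge_diff_kappa_frob:
  assumes "val_ge v w 0"
  shows "val_ge v (w - kappa w ^ p) 1"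
proof -
  have "w = (\<Sum>i<p. coord w i ^ p * t ^ i)"
    by (simp only: coord_expansion)
  also have "\<dots> = coord w 0 ^ p * t ^ 0 + (\<Sum>i\<in>{..<p} - {0}. coord w i ^ p * t ^ i)"
    using p_pos by (intro sum.remove) auto
  finally have "w - kappa w ^ p = (\<Sum>i\<in>{..<p} - {0}. coord w i ^ p * t ^ i)"
    by (simp add: kappa_def algebra_simps)
  also have "val_ge v \<dots> 1"
  proof (intro val_ge_sum)
    fix i assume i: "i \<in> {..<p} - {0}"
    then have "val_ge v (coord w i ^ p * t ^ i) (0 + int i)"
      by (intro val_ge_mult val_ge_power val_ge_coord val_ge_t_power assms) auto
    then show "val_ge v (coord w i ^ p * t ^ i) 1"
      using i by (elim val_ge_mono) auto
  qed
  finally show ?thesis .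
qed

lemma emb_of_nat: "emb (of_nat n) = of_nat n"
  by (induction n) (auto simp: emb_0 emb_1 emb_add)

text \<open>In the sum of the (1 - i) c_i^p t^i the term i = 1 drops out. The term i = 0 has a
  positive valuation divisible by p, hence at least 2, and for i >= 2 the factor t^i suffices. This
  makes orders and residues at simple poles independent of the uniformizer.\<close>

lemma val_ge_diff_theta:
  assumes s: "v s = 1"
  shows "val_ge v (s - theta s) 2"
proof -
  have s0: "s \<noteq> 0"
    using s v_0 by auto
  have "s - theta s = (\<Sum>i<p. coord s i ^ p * t ^ i) - theta s"
    by (simp only: coord_expansion)
  also have "\<dots> = (\<Sum>i<p. (1 - of_nat i) * (coord s i ^ p * t ^ i))"
    by (simp add: theta_def algebra_simps sum_subtractf)
  also have "val_ge v \<dots> 2"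
  proof (intro val_ge_sum)
    fix i assume i: "i \<in> {..<p}"
    show "val_ge v ((1 - of_nat i) * (coord s i ^ p * t ^ i)) 2"
    proof (cases "i = 1 \<or> coord s i = 0")
      case True
      then show ?thesis
        by (auto simp: frob_0 val_ge_0)
    next
      case False
      have vi: "1 \<le> int p * v (coord s i) + int i"
        using v_coord[OF s0, of i] i s False by auto
      have "2 \<le> int p * v (coord s i) + int i"
      proof (cases "i = 0")
        case True
        then have "0 < int p * v (coord s i)"
          using vi by simp
        then have "0 < v (coord s i)"
          using p_pos by (simp add: zero_less_mult_iff)
        then have "int p * 1 \<le> int p * v (coord s i)"
          by (intro mult_left_mono) auto
        moreover have "2 \<le> int p"
          using p_gt_1 by simp
        ultimately show ?thesis
          by linarith
      next
        case i0: False
        have "val_ge v (coord s i) 0"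
          using i s by (intro val_ge_coord) (auto simp: val_ge_def)
        then have "0 \<le> int p * v (coord s i)"
          using False by (simp add: val_ge_def)
        then show ?thesis
          using False i0 by simp
      qed
      then have "val_ge v (coord s i ^ p * t ^ i) 2"
        using False t_nonzero by (simp add: val_ge_def v_mult v_power v_t)
      moreover have "val_ge v (1 - of_nat i) 0"
        using val_ge_emb[of "1 - of_nat i"] by (simp add: emb_diff emb_1 emb_of_nat)
      ultimately show ?thesis
        using val_ge_mult by fastforce
    qed
  qed
  finally show ?thesis .
qed

text \<open>By \<open>val_ge_diff_theta\<close>, s and t ds/dt agree to leading order, so ds/dt is a
  unit at the place.\<close>

lemma theta_uniformizer:
  assumes s: "v s = 1"
  shows "theta s \<noteq> 0" "v (theta s) = 1"
proof -
  have s0: "s \<noteq> 0"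
    using s v_0 by auto
  have "theta s \<noteq> 0 \<and> v (theta s) = 1"
  proof (cases "s - theta s = 0")
    case False
    have "v s < v (- (s - theta s))"
      using val_ge_diff_theta[OF s] False s unfolding v_minus by (simp add: val_ge_def)
    from v_add_less[OF s0 _ this] False s show ?thesis
      by auto
  qed (use s s0 in auto)
  then show "theta s \<noteq> 0" "v (theta s) = 1" by auto
qed

text \<open>Every presentation u ds by a uniformizer gives w = u theta(s) with v(theta s) = 1, so
  the description in \<open>form_val\<close> has only one value.\<close>

lemma form_val_log_form:
  assumes w: "w \<noteq> 0"
  shows "form_val emb v (log_form w) = v w - 1"
  unfolding form_val_def
proof (rule the_equality)
  show "\<exists>s u. v s = 1 \<and> log_form w = form emb u s \<and> u \<noteq> 0 \<and> v u = v w - 1"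
    using w t_nonzero v_t
    by (intro exI[of _ t] exI[of _ "w / t"]) (simp add: log_form_eq v_divide)
next
  fix k
  assume "\<exists>s u. v s = 1 \<and> log_form w = form emb u s \<and> u \<noteq> 0 \<and> v u = k"
  then obtain s u where su: "v s = 1" "log_form w = form emb u s" "u \<noteq> 0" "v u = k"
    by blast
  then have "w = u * theta s"
    by (simp add: form_eq_log_form log_form_inj)
  then show "k = v w - 1"
    using su theta_uniformizer[OF su(1)] by (simp add: v_mult)
qed

lemma emb_residue_unique:
  assumes "val_ge v (f - emb a) 1" "val_ge v (f - emb b) 1"
  shows "a = b"
proof -
  from val_ge_diff[OF assms(2,1)] have "val_ge v (emb (a - b)) 1"
    by (simp add: emb_diff)
  then show "a = b"
    by (simp add: val_ge_def v_emb emb_eq_0_iff)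
qed

lemma local_expansion_residue:
  assumes s: "v s = 1" and u: "val_ge v u (- 1)" and L: "local_expansion emb v s u L"
  shows "val_ge v (s * u - emb (fls_residue L)) 1"
proof -
  have s0: "s \<noteq> 0"
    using s v_0 by auto
  let ?d = "fls_subdegree L"
  have exp: "val_ge v (u - (\<Sum>i\<in>{?d..n}. emb (fls_nth L i) * s powi i)) (n + 1)" for n
    using L by (auto simp: local_expansion_def)
  \<comment> \<open>An earlier first term would equal u up to higher order, although u has at most a
    simple pole.\<close>
  have d: "- 1 \<le> ?d"
  proof (rule ccontr)
    assume d: "\<not> - 1 \<le> ?d"
    define z where "z = emb (fls_nth L ?d) * s powi ?d"
    have "L \<noteq> 0"
      using d by auto
    then have "fls_nth L ?d \<noteq> 0"
      by (rule nth_fls_subdegree_nonzero)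
    then have z: "z \<noteq> 0" "v z = ?d"
      using s s0 by (simp_all add: z_def v_mult v_emb v_power_int emb_eq_0_iff)
    have "val_ge v (u - z) (?d + 1)"
      using exp[of ?d] by (simp add: z_def)
    moreover have "val_ge v u (?d + 1)"
      using u d by (elim val_ge_mono) auto
    ultimately have "val_ge v (u - (u - z)) (?d + 1)"
      by (rule val_ge_diff[rotated])
    then show False
      using z by (simp add: val_ge_def)
  qed
  \<comment> \<open>If the subdegree is above -1, the sum is empty and the residue coefficient is
    zero, so the formula still holds.\<close>
  have "(\<Sum>i\<in>{?d..- 1}. emb (fls_nth L i) * s powi i) = emb (fls_residue L) / s"
  proof (cases "?d = - 1")
    case True
    then show ?thesis
      by (simp add: power_int_minus divide_inverse)
  next
    case False
    then have "fls_nth L (- 1) = 0"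
      using d by (intro fls_eq0_below_subdegree) auto
    then show ?thesis
      using False d by (simp add: emb_0)
  qed
  with exp[of "- 1"] have "val_ge v (u - emb (fls_residue L) / s) 0"
    by simp
  moreover have "val_ge v s 1"
    using s by (simp add: val_ge_def)
  ultimately have "val_ge v (s * (u - emb (fls_residue L) / s)) (1 + 0)"
    by (intro val_ge_mult)
  then show ?thesis
    using s0 by (simp add: right_diff_distrib)
qed

text \<open>Digits by successive approximation: subtract the constant congruent to the current
  remainder, divide by \<open>t\<close>, and repeat.\<close>

lemma ex_local_expansion:
  assumes rational: "rational_place emb v" and w: "val_ge v (w - emb a) 1"
  shows "\<exists>L. local_expansion emb v t (w / t) L \<and> fls_residue L = a"
proof -
  define digit where "digit f = (SOME b. val_ge v (f - emb b) 1)" for f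
  have digit: "val_ge v (f - emb (digit f)) 1" if "val_ge v f 0" for f
  proof -
    have "\<exists>b. val_ge v (f - emb b) 1"
      using rational that by (auto simp: rational_place_def)
    then show ?thesis
      unfolding digit_def by (rule someI_ex)
  qed
  define shift where "shift f = (f - emb (digit f)) / t" for f
  have shift: "val_ge v (shift f) 0" if "val_ge v f 0" for f
    using digit[OF that] t_nonzero v_t
    by (cases "f - emb (digit f) = 0") (auto simp: shift_def val_ge_def v_divide)
  define r where "r n = (shift ^^ n) w" for n
  define c where "c n = digit (r n)" for n
  have w0: "val_ge v w 0"
    using val_ge_add[OF val_ge_mono[OF w, of 0] val_ge_emb[of a]] by simp
  have r: "val_ge v (r n) 0" for n
    by (induction n) (auto simp: r_def w0 shift)
  have step: "r n = emb (c n) + t * r (Suc n)" for n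
    using t_nonzero by (simp add: r_def c_def shift_def)
  have partial: "w = (\<Sum>k<n. emb (c k) * t ^ k) + t ^ n * r n" for n
  proof (induction n)
    case (Suc n)
    then show ?case
      by (subst Suc, subst step) (simp add: algebra_simps)
  qed (simp add: r_def)
  \<comment> \<open>Division of w by \<open>t\<close> moves digit k to exponent k - 1.\<close>
  define F where "F i = (if i < - 1 then 0 else c (nat (i + 1)))" for i
  define L where "L = Abs_fls F"
  have nth: "fls_nth L i = F i" for i
    unfolding L_def by (rule nth_Abs_fls_lower_bound[of "- 1"]) (auto simp: F_def)
  have res: "fls_residue L = a"
  proof -
    have "val_ge v (w - emb (c 0)) 1"
      using digit[OF w0] by (simp add: c_def r_def)
    with w have "c 0 = a"
      using emb_residue_unique by blast
    then show ?thesis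
      by (simp add: nth F_def)
  qed
  have "local_expansion emb v t (w / t) L"
    unfolding local_expansion_def
  proof
    fix n :: int
    have d: "- 1 \<le> fls_subdegree L"
      by (cases "L = 0") (auto intro: fls_subdegree_geI simp: nth F_def)
    have sum_eq: "(\<Sum>i\<in>{fls_subdegree L..n}. emb (fls_nth L i) * t powi i)
        = (\<Sum>i\<in>{- 1..n}. emb (fls_nth L i) * t powi i)"
      using d by (intro sum.mono_neutral_left) (auto simp: emb_0)
    show "val_ge v (w / t - (\<Sum>i\<in>{fls_subdegree L..n}. emb (fls_nth L i) * t powi i)) (n + 1)"
    proof (cases "n < - 1")
      case True
      have "val_ge v (w / t) (- 1)"
        using w0 t_nonzero v_t by (cases "w = 0") (auto simp: val_ge_def v_divide)
      then show ?thesis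
        unfolding sum_eq using True by (auto elim: val_ge_mono)
    next
      case False
      \<comment> \<open>The number of exponents from -1 to n; the error t^N r_N / t then has order
        at least N - 1 = n + 1.\<close>
      define N where "N = nat (n + 2)"
      have "(\<Sum>i\<in>{- 1..n}. emb (fls_nth L i) * t powi i) = (\<Sum>k<N. emb (c k) * t ^ k / t)"
      proof (rule sum.reindex_bij_witness[of _ "\<lambda>k. int k - 1" "\<lambda>i. nat (i + 1)"])
        fix i assume i: "i \<in> {- 1..n}"
        have "t powi i * t = t powi (i + 1)"
          using t_nonzero by (simp add: power_int_add_1)
        also have "\<dots> = t ^ nat (i + 1)"
          using i by (simp add: power_int_def)
        finally show "emb (c (nat (i + 1))) * t ^ nat (i + 1) / t = emb (fls_nth L i) * t powi i"
          using t_nonzero i by (simp add: nth F_def field_simps)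
      qed (use False in \<open>auto simp: N_def\<close>)
      also have "\<dots> = (\<Sum>k<N. emb (c k) * t ^ k) / t"
        by (simp add: sum_divide_distrib)
      finally have "w / t - (\<Sum>i\<in>{- 1..n}. emb (fls_nth L i) * t powi i) = t ^ N * r N / t"
        by (subst partial[of N]) (simp add: add_divide_distrib)
      also have "\<dots> = t ^ (N - 1) * r N"
        using False t_nonzero by (cases N) (auto simp: N_def)
      also have "val_ge v \<dots> (int (N - 1) + 0)"
        by (intro val_ge_mult val_ge_t_power r)
      finally show ?thesis
        unfolding sum_eq using False by (simp add: N_def nat_diff_distrib add.commute)
    qed
  qed
  with res show ?thesis by blast
qed

text \<open>Existence is \<open>ex_local_expansion\<close>. For uniqueness, a presentation u ds has
  s u congruent to its residue, and s u is congruent to w = u theta(s).\<close>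

lemma residue_log_form:
  assumes rational: "rational_place emb v" and w: "val_ge v (w - emb a) 1"
  shows "residue emb v (log_form w) = a"
  unfolding residue_def
proof (rule the_equality)
  show "\<exists>s u L. v s = 1 \<and> log_form w = form emb u s \<and> local_expansion emb v s u L \<and>
      a = fls_residue L"
    using ex_local_expansion[OF assms] v_t log_form_eq by blast
next
  fix b
  assume "\<exists>s u L. v s = 1 \<and> log_form w = form emb u s \<and> local_expansion emb v s u L \<and>
      b = fls_residue L"
  then obtain s u L where s: "v s = 1" and eq: "log_form w = form emb u s"
    and L: "local_expansion emb v s u L" and b: "b = fls_residue L"
    by blast
  have w_eq: "w = u * theta s"
    using eq by (simp add: form_eq_log_form log_form_inj)
  have "val_ge v w 0"
    using val_ge_add[OF val_ge_mono[OF w, of 0] val_ge_emb[of a]] by simp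
  then have u: "val_ge v u (- 1)"
    using theta_uniformizer[OF s] by (cases "u = 0") (auto simp: w_eq val_ge_def v_mult)
  \<comment> \<open>A simple pole of u is absorbed by the order 2 of s - theta s; a higher pole
    would not be.\<close>
  have "val_ge v (u * (s - theta s)) (- 1 + 2)"
    by (intro val_ge_mult u val_ge_diff_theta s)
  then have "val_ge v (s * u - w) 1"
    by (simp add: w_eq algebra_simps)
  from val_ge_diff[OF local_expansion_residue[OF s u L] this] have "val_ge v (w - emb b) 1"
    by (simp add: b)
  with w show "b = a"
    using emb_residue_unique by blast
qed

lemma cartier_log_form: "cartier emb p (log_form w) = log_form (kappa w)"
  unfolding cartier_def
proof (rule the_equality)
  \<comment> \<open>Passing from dt to dt/t turns the coefficient with index p - 1 of w / t into the
    coefficient with index 0 of w.\<close>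
  have "kappa ((\<Sum>i<p. coord (w / t) i ^ p * t ^ i) * theta t) = coord (w / t) (p - 1) * theta t"
    by (rule kappa_form)
  then have kappa: "kappa w = coord (w / t) (p - 1) * t"
    using t_nonzero by (simp add: coord_expansion theta_t)
  then show "\<exists>x f. separating emb x \<and> log_form w = form emb (\<Sum>i<p. f i ^ p * x ^ i) x \<and>
      log_form (kappa w) = form emb (f (p - 1)) x"
    using separating_uniformizer[OF place v_t]
    by (intro exI[of _ t] exI[of _ "coord (w / t)"] conjI)
      (simp_all only: coord_expansion kappa form_t[symmetric] log_form_eq[of w])
next
  fix \<eta>
  assume "\<exists>x f. separating emb x \<and> log_form w = form emb (\<Sum>i<p. f i ^ p * x ^ i) x \<and>
      \<eta> = form emb (f (p - 1)) x"
  then obtain x f where "log_form w = form emb (\<Sum>i<p. f i ^ p * x ^ i) x"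
    "\<eta> = form emb (f (p - 1)) x"
    by blast
  then show "\<eta> = log_form (kappa w)"
    by (simp add: form_eq_log_form log_form_inj kappa_form)
qed

lemma cartier_funpow_log_form:
  "(cartier emb p ^^ n) (log_form w) = log_form ((kappa ^^ n) w)"
  by (induction n) (auto simp: cartier_log_form)

text \<open>Iterates the congruence of w with the p-th power of \<open>kappa w\<close>; each
  application of \<open>kappa\<close> contributes one Frobenius to the residue class.\<close>

lemma residue_kappa_funpow:
  assumes "val_ge v w 0" "val_ge v ((kappa ^^ n) w - emb b) 1"
  shows "val_ge v (w - emb (b ^ p ^ n)) 1"
  using assms
proof (induction n arbitrary: w)
  case (Suc n)
  define b' where "b' = b ^ p ^ n"
  have "val_ge v (kappa w - emb b') 1"
    unfolding b'_def using Suc.prems by (intro Suc.IH val_ge_kappa) (auto simp: funpow_swap1)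
  then have "val_ge v ((kappa w - emb b') ^ p) 1"
  proof (cases "kappa w - emb b' = 0")
    case False
    assume "val_ge v (kappa w - emb b') 1"
    with False have "1 * 1 \<le> int p * v (kappa w - emb b')"
      using p_pos by (intro mult_mono) (auto simp: val_ge_def)
    with False show ?thesis
      by (simp add: val_ge_def v_power)
  qed (simp add: frob_0 val_ge_0)
  with val_ge_diff_kappa_frob[OF Suc.prems(1)]
  have "val_ge v ((w - kappa w ^ p) + (kappa w - emb b') ^ p) 1"
    by (intro val_ge_add)
  then have "val_ge v (w - emb (b' ^ p)) 1"
    by (simp add: frob_diff emb_power)
  then show ?case
    by (simp add: b'_def mult.commute flip: power_mult)
qed simp

end

section \<open>Linearity of forms, iterated Cartier operator and residues in one global
  coordinate\<close>

context p_basis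
begin

lemma kappa_funpow_add: "(kappa ^^ n) (f + g) = (kappa ^^ n) f + (kappa ^^ n) g"
  by (induction n) (auto simp: kappa_add)

lemma kappa_funpow_0: "(kappa ^^ n) 0 = 0"
  by (induction n) (auto simp: kappa_0)

text \<open>For constants with a^(p^n) = a this is linearity of the n-fold operator, which makes the
  Cartier code linear over F_q.\<close>

lemma kappa_funpow_frob_mult: "(kappa ^^ n) (a ^ p ^ n * f) = a * (kappa ^^ n) f"
proof (induction n arbitrary: f)
  case (Suc n)
  have "a ^ p ^ Suc n = (a ^ p ^ n) ^ p"
    by (simp add: mult.commute flip: power_mult)
  then show ?case
    by (simp add: funpow_swap1 kappa_frob_mult Suc)
qed simp

end

context curve_basis
begin

text \<open>The chain rule ds/s = (theta(s)/s) dt/t. Applied to \<open>t\<close> itself it also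
  excludes theta(s) = 0.\<close>

lemma log_form_change_of_basis:
  assumes "curve_basis p emb s"
  shows "theta s \<noteq> 0" "log_form w = curve_basis.log_form p s (w * s / theta s)"
proof -
  interpret S: curve_basis p emb s by fact
  have "t = theta s / s * S.theta t"
    using theta_change_of_basis[OF p_basis_axioms S.p_basis_axioms, of t] by (simp add: theta_t)
  then show nz: "theta s \<noteq> 0"
    using t_nonzero by auto
  have "log_form w = form emb (w / theta s) s"
    using nz by (simp add: form_eq_log_form)
  then show "log_form w = S.log_form (w * s / theta s)"
    by (simp add: S.form_t)
qed

lemma form_val_eq:
  assumes "place emb v" "v s = 1" "w \<noteq> 0"
  shows "form_val emb v (log_form w) = v (w * s / theta s) - 1"
proof -
  interpret S: curve_place p emb s v
    by (rule curve_place_uniformizer) fact+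
  have "w * s / theta s \<noteq> 0"
    using assms S.t_nonzero log_form_change_of_basis(1)[OF S.curve_basis_axioms] by simp
  then show ?thesis
    by (subst log_form_change_of_basis(2)[OF S.curve_basis_axioms]) (rule S.form_val_log_form)
qed

lemma Omega_0: "log_form 0 \<in> Omega emb A"
  by (auto simp: Omega_def forms_eq zero_form_eq)

lemma Omega_add:
  assumes "log_form w \<in> Omega emb A" "log_form w' \<in> Omega emb A"
  shows "log_form (w + w') \<in> Omega emb A"
\<comment> \<open>The zero form belongs to \<open>Omega\<close> by a separate clause, so
  \<open>form_val\<close> may only be used where neither the forms nor their sum vanish.\<close>
proof (cases "w = 0 \<or> w' = 0 \<or> w + w' = 0")
  case True
  then show ?thesis
    using assms Omega_0 by auto
next
  case False
  have "Poly_Mapping.lookup A v \<le> form_val emb v (log_form (w + w'))" if v: "place emb v" for v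
  proof -
    interpret valued emb v by (rule valued.intro) fact
    obtain s where s: "v s = 1"
      using v_uniformizer by blast
    interpret S: curve_place p emb s v
      by (rule curve_place_uniformizer) fact+
    let ?c = "s / theta s"
    have c: "?c \<noteq> 0"
      using S.t_nonzero log_form_change_of_basis(1)[OF S.curve_basis_axioms] by simp
    have "min (v (w * ?c)) (v (w' * ?c)) \<le> v (w * ?c + w' * ?c)"
    proof (intro v_add)
      have "(w + w') * ?c \<noteq> 0"
        using False c by (simp only: mult_eq_0_iff de_Morgan_disj) simp
      then show "w * ?c + w' * ?c \<noteq> 0"
        by (simp only: distrib_right not_False_eq_True)
    qed (use False c in simp_all)
    then have "min (form_val emb v (log_form w)) (form_val emb v (log_form w'))
        \<le> form_val emb v (log_form (w + w'))"
      using False v s by (simp add: form_val_eq distrib_right add_divide_distrib)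
    moreover have "Poly_Mapping.lookup A v \<le> form_val emb v (log_form w)"
      "Poly_Mapping.lookup A v \<le> form_val emb v (log_form w')"
      using assms v False by (auto simp: Omega_def zero_form_eq log_form_inj)
    ultimately show ?thesis
      by linarith
  qed
  then show ?thesis
    by (auto simp: Omega_def forms_eq)
qed

lemma Omega_scale:
  assumes "log_form w \<in> Omega emb A"
  shows "log_form (emb a * w) \<in> Omega emb A"
proof (cases "a = 0 \<or> w = 0")
  case True
  then show ?thesis
    using Omega_0 by (auto simp: emb_0)
next
  case False
  have "form_val emb v (log_form (emb a * w)) = form_val emb v (log_form w)" if v: "place emb v" for v
  proof -
    interpret valued emb v by (rule valued.intro) fact
    obtain s where s: "v s = 1"
      using v_uniformizer by blast
    interpret S: curve_place p emb s v
      by (rule curve_place_uniformizer) fact+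
    have "w * s / theta s \<noteq> 0" "emb a \<noteq> 0"
      using False S.t_nonzero log_form_change_of_basis(1)[OF S.curve_basis_axioms]
      by (auto simp: emb_eq_0_iff)
    then have "v (emb a * (w * s / theta s)) = v (w * s / theta s)"
      using v_mult[of "emb a" "w * s / theta s"] v_emb[of a] by simp
    then show ?thesis
      using False v s by (simp add: form_val_eq emb_eq_0_iff mult.assoc)
  qed
  then show ?thesis
    using assms False by (auto simp: Omega_def forms_eq zero_form_eq log_form_inj)
qed

lemma residue_eq:
  assumes "rational_place emb v" "v s = 1" "val_ge v (w * s / theta s - emb a) 1"
  shows "residue emb v (log_form w) = a"
proof -
  interpret S: curve_place p emb s v
    using assms by (intro curve_place_uniformizer) (auto simp: rational_place_def)
  show ?thesis
    by (subst log_form_change_of_basis(2)[OF S.curve_basis_axioms])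
      (intro S.residue_log_form assms)
qed

text \<open>With at most a simple pole the local coordinate is integral, so its residue class exists
  at a rational place. Linearity of the residue is read off from this congruence.\<close>

lemma residue_congruence:
  assumes rational: "rational_place emb v" and s: "v s = 1" and A: "Poly_Mapping.lookup A v = - 1"
    and w: "log_form w \<in> Omega emb A"
  shows "val_ge v (w * s / theta s - emb (residue emb v (log_form w))) 1"
proof -
  have v: "place emb v"
    using rational by (simp add: rational_place_def)
  have "val_ge v (w * s / theta s) 0"
  proof (cases "w = 0")
    case False
    then have "- 1 \<le> form_val emb v (log_form w)"
      using w v A by (auto simp: Omega_def zero_form_eq log_form_inj)
    then show ?thesis
      using form_val_eq[OF v s False] by (simp add: val_ge_def)
  qed (simp add: val_ge_def)
  then obtain a where "val_ge v (w * s / theta s - emb a) 1"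
    using rational by (auto simp: rational_place_def)
  with residue_eq[OF rational s this] show ?thesis
    by simp
qed

lemma residue_0:
  assumes "rational_place emb v"
  shows "residue emb v (log_form 0) = 0"
proof -
  obtain s where "v s = 1"
    using assms by (auto simp: rational_place_def place_def)
  then show ?thesis
    by (rule residue_eq[OF assms]) (simp add: emb_0 val_ge_def)
qed

lemma residue_add:
  assumes rational: "rational_place emb v" and A: "Poly_Mapping.lookup A v = - 1"
    and w: "log_form w \<in> Omega emb A" "log_form w' \<in> Omega emb A"
  shows "residue emb v (log_form (w + w')) = residue emb v (log_form w) + residue emb v (log_form w')"
proof -
  interpret valued emb v
    using rational by (intro valued.intro) (simp add: rational_place_def)
  obtain s where s: "v s = 1"
    using v_uniformizer by blast
  note cong = residue_congruence[OF rational s A]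
  from val_ge_add[OF cong[OF w(1)] cong[OF w(2)]] show ?thesis
    by (intro residue_eq[OF rational s]) (simp add: emb_add distrib_right add_divide_distrib algebra_simps)
qed

lemma residue_scale:
  assumes rational: "rational_place emb v" and A: "Poly_Mapping.lookup A v = - 1"
    and w: "log_form w \<in> Omega emb A"
  shows "residue emb v (log_form (emb a * w)) = a * residue emb v (log_form w)"
proof -
  interpret valued emb v
    using rational by (intro valued.intro) (simp add: rational_place_def)
  obtain s where s: "v s = 1"
    using v_uniformizer by blast
  from val_ge_mult[OF val_ge_emb[of a] residue_congruence[OF rational s A w]] show ?thesis
    by (intro residue_eq[OF rational s]) (simp add: emb_mult right_diff_distrib mult.assoc)
qed

lemma residue_cartier_fixed:
  assumes rational: "rational_place emb v" and A: "Poly_Mapping.lookup A v = - 1"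
    and w: "log_form w \<in> Omega emb A" and fixed: "(cartier emb p ^^ n) (log_form w) = log_form w"
  shows "residue emb v (log_form w) ^ p ^ n = residue emb v (log_form w)"
proof -
  define a where "a = residue emb v (log_form w)"
  have v: "place emb v"
    using rational by (simp add: rational_place_def)
  then obtain s where s: "v s = 1"
    by (auto simp: place_def)
  interpret S: curve_place p emb s v
    by (rule curve_place_uniformizer) fact+
  define w' where "w' = w * s / theta s"
  have eq: "log_form w = S.log_form w'"
    unfolding w'_def by (rule log_form_change_of_basis(2)[OF S.curve_basis_axioms])
  \<comment> \<open>The Cartier operator does not refer to a coordinate, so a fixed form is fixed by
    \<open>kappa\<close> in the local coordinate as well.\<close>
  have "(S.kappa ^^ n) w' = w'"
    using fixed unfolding eq S.cartier_funpow_log_form S.log_form_inj .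
  moreover have cong: "val_ge v (w' - emb a) 1"
    unfolding w'_def a_def by (rule residue_congruence[OF rational s A w])
  moreover have "val_ge v w' 0"
    using S.val_ge_add[OF S.val_ge_mono[OF cong, of 0] S.val_ge_emb[of a]] by simp
  ultimately have "val_ge v (w' - emb (a ^ p ^ n)) 1"
    by (intro S.residue_kappa_funpow) auto
  with cong show ?thesis
    using S.emb_residue_unique unfolding a_def by blast
qed

end

section \<open>Finite subfields and the characteristic\<close>

lemma subfield_power_card:
  fixes S :: "'k::{field,finite} set"
  assumes S: "is_subfield S" and a: "a \<in> S"
  shows "a ^ card S = a"
proof (cases "a = 0")
  case True
  then show ?thesis
    using a by (auto simp: zero_power card_gt_0_iff)
next
  case False
  let ?U = "S - {0}"
  \<comment> \<open>Multiplication by a permutes the nonzero elements; comparing their products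
    gives a^(q-1) = 1.\<close>
  have "bij_betw (\<lambda>b. a * b) ?U ?U"
  proof (rule bij_betwI[of _ _ _ "\<lambda>b. inverse a * b"])
    show "(\<lambda>b. a * b) \<in> ?U \<rightarrow> ?U" "(\<lambda>b. inverse a * b) \<in> ?U \<rightarrow> ?U"
      using a False by (auto intro: is_subfieldD(4,5)[OF S])
  qed (use False in auto)
  then have "\<Prod>?U = (\<Prod>b\<in>?U. a * b)"
    by (rule prod.reindex_bij_betw[symmetric])
  also have "\<dots> = a ^ card ?U * \<Prod>?U"
    by (simp add: prod.distrib)
  finally have "a ^ card ?U = 1"
    by simp
  moreover have "card S = Suc (card ?U)"
    using is_subfieldD(1)[OF S] by (intro card.remove) auto
  ultimately show ?thesis
    by simp
qed

text \<open>X^q - X has at most q roots, and the q elements of the subfield are already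
  roots.\<close>

lemma subfield_eq_fixed_points:
  fixes S :: "'k::{field,finite} set"
  assumes S: "is_subfield S"
  shows "S = {a. a ^ card S = a}"
proof (rule card_seteq)
  show "S \<subseteq> {a. a ^ card S = a}"
    using subfield_power_card[OF S] by auto
  have two: "2 \<le> card S"
    using card_mono[of S "{0, 1}"] is_subfieldD(1,2)[OF S] by simp
  define f where "f = monom (1::'k) (card S) - monom 1 1"
  have "coeff f (card S) = 1"
    using two by (simp add: f_def)
  then have f0: "f \<noteq> 0"
    by auto
  have deg: "degree f \<le> card S"
    unfolding f_def using two by (intro degree_diff_le) (auto simp: degree_monom_eq)
  have eq: "{a. a ^ card S = a} = {a. poly f a = 0}"
    by (auto simp: f_def poly_monom)
  have "card {a::'k. a ^ card S = a} = card {a. poly f a = 0}"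
    by (rule arg_cong[OF eq])
  also have "\<dots> \<le> degree f"
    by (rule card_poly_roots_bound[OF f0])
  also note deg
  finally show "card {a::'k. a ^ card S = a} \<le> card S" .
qed simp

lemma curve_of_card:
  fixes emb :: "'k::{field,finite} \<Rightarrow> 'f::field"
  assumes "prime p" and card: "CARD('k) = p ^ n" and ff: "function_field_of_curve emb"
  shows "curve p emb"
proof -
  have hom: "emb 1 = 1" "\<And>a b. emb (a + b) = emb a + emb b"
    using ff by (auto simp: function_field_of_curve_def field_embedding_def)
  have emb0: "emb 0 = 0"
    using hom(2)[of 0 0] by (metis add_cancel_right_right)
  have emb_nat: "emb (of_nat k) = of_nat k" for k
    by (induction k) (auto simp: hom emb0)
  \<comment> \<open>Translation by 1 permutes K, so the order of K, a power of p, vanishes in K and,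
    through \<open>emb\<close>, in F.\<close>
  have "(\<Sum>a\<in>UNIV. a + (1::'k)) = (\<Sum>a\<in>UNIV. a)"
    by (rule sum.reindex_bij_witness[of _ "\<lambda>a. a - 1" "\<lambda>a. a + 1"]) auto
  then have "of_nat CARD('k) = (0::'k)"
    by (simp add: sum.distrib)
  then have "of_nat (p ^ n) = (0::'f)"
    by (metis card emb_nat emb0)
  then have "of_nat p = (0::'f)"
    by simp
  then have "CHAR('f) dvd p"
    by (simp add: of_nat_eq_0_iff_char_dvd)
  moreover have "CHAR('f) \<noteq> 1"
    using of_nat_CHAR[where 'a='f] by auto
  ultimately have "CHAR('f) = p"
    using \<open>prime p\<close> by (auto simp: prime_nat_iff)
  with assms show ?thesis
    by unfold_locales
qed

lemma lookup_point_divisor: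
  assumes "inj P"
  shows "Poly_Mapping.lookup (point_divisor P) (P i) = 1"
proof -
  have "Poly_Mapping.lookup (point_divisor P) (P i) = (\<Sum>j\<in>UNIV. if j = i then 1 else 0)"
    unfolding point_divisor_def lookup_sum
    using assms by (intro sum.cong refl) (auto simp: lookup_single inj_eq)
  then show ?thesis
    by simp
qed

theorem proposition4p3:
  fixes emb :: "'k::{field,finite} \<Rightarrow> 'f::field"
    and p m q l :: nat
    and Fq :: "'k set"
    and P :: "'n::finite \<Rightarrow> 'f \<Rightarrow> int"
    and G :: "'f divisor"
  assumes "prime p" and "m \<ge> 1" and "q = p ^ m" and "l \<ge> 1"
    and "CARD('k) = q ^ l"
    and "is_subfield Fq" and "card Fq = q"
    and "function_field_of_curve emb"
    and "inj P" and "\<forall>i. rational_place emb (P i)"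
    and "is_divisor emb G"
    and "Poly_Mapping.keys G \<inter> Poly_Mapping.keys (point_divisor P) = {}"
  shows "subcode Fq (Cartier_code emb p m P G) (subfield_subcode Fq (AG_code emb P G))"
proof -
  have "curve p emb"
    using assms by (intro curve_of_card[of p "m * l"]) (auto simp: power_mult)
  then interpret curve p emb .
  have rational: "rational_place emb (P i)" for i
    using assms(10) by blast
  \<comment> \<open>Index types are nonempty, so there is a point; a uniformizer there provides the
    coordinate of all forms, also for the other points.\<close>
  then obtain i0 :: 'n and t where t: "P i0 t = 1" and v: "place emb (P i0)"
    by (meson place_def rational_place_def)
  interpret T: curve_place p emb t "P i0"
    by (rule curve_place_uniformizer) fact+
  let ?A = "G - point_divisor P"
  \<comment> \<open>Disjoint supports and distinct points: the forms concerned have at most simple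
    poles at all P_i.\<close>
  have A: "Poly_Mapping.lookup ?A (P i) = - 1" for i
  proof -
    have "P i \<in> Poly_Mapping.keys (point_divisor P)"
      using lookup_point_divisor[OF assms(9)] by (simp add: in_keys_iff)
    then have "P i \<notin> Poly_Mapping.keys G"
      using assms(12) by blast
    then show ?thesis
      using lookup_point_divisor[OF assms(9)] by (simp add: lookup_minus in_keys_iff)
  qed
  have Fq: "a \<in> Fq \<longleftrightarrow> a ^ p ^ m = a" for a
    using subfield_eq_fixed_points[OF assms(6)] assms(3,7) by auto
  \<comment> \<open>\<open>W\<close> and \<open>W'\<close> are the coordinate spaces of the forms
    behind the two codes, so that linearity can be checked for functions instead of classes of
    forms.\<close>
  define W where "W = {w. T.log_form w \<in> Omega emb ?A}"
  define W' where "W' = {w \<in> W. (T.kappa ^^ m) w = w}"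
  define R where "R w = residues emb P (T.log_form w)" for w
  have Omega: "Omega emb ?A = T.log_form ` W"
    by (auto simp: W_def Omega_def T.forms_eq)
  have AG: "AG_code emb P G = R ` W"
    unfolding AG_code_def Omega R_def by (rule image_image)
  have Car: "Cartier_code emb p m P G = R ` W'"
  proof -
    have "{\<omega> \<in> Omega emb ?A. (cartier emb p ^^ m) \<omega> = \<omega>} = T.log_form ` W'"
      unfolding Omega W'_def by (auto simp: T.cartier_funpow_log_form T.log_form_inj)
    then show ?thesis
      unfolding Cartier_code_def R_def by (simp add: image_image)
  qed
  have W: "0 \<in> W" "\<And>w w'. w \<in> W \<Longrightarrow> w' \<in> W \<Longrightarrow> w + w' \<in> W" "\<And>a w. w \<in> W \<Longrightarrow> emb a * w \<in> W"
    by (auto simp: W_def T.Omega_0 T.Omega_add T.Omega_scale)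
  have W': "0 \<in> W'" "\<And>w w'. w \<in> W' \<Longrightarrow> w' \<in> W' \<Longrightarrow> w + w' \<in> W'"
    using W by (auto simp: W'_def T.kappa_funpow_0 T.kappa_funpow_add)
  have W'_scale: "emb a * w \<in> W'" if "a \<in> Fq" "w \<in> W'" for a w
  proof -
    have "emb a ^ p ^ m = emb a"
      using that Fq by (simp flip: emb_power)
    then show ?thesis
      using that W T.kappa_funpow_frob_mult[of m "emb a" w] by (auto simp: W'_def)
  qed
  have R: "R 0 = 0" "\<And>w w'. w \<in> W \<Longrightarrow> w' \<in> W \<Longrightarrow> R (w + w') = R w + R w'"
    "\<And>a w. w \<in> W \<Longrightarrow> R (emb a * w) = a *s R w"
    by (auto simp: R_def residues_def vec_eq_iff W_def T.residue_0[OF rational]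
        T.residue_add[OF rational A] T.residue_scale[OF rational A])
  have in_Fq: "R w $ i \<in> Fq" if "w \<in> W'" for w i
  proof -
    have w: "T.log_form w \<in> Omega emb ?A" and "(T.kappa ^^ m) w = w"
      using that by (auto simp: W'_def W_def)
    then have "(cartier emb p ^^ m) (T.log_form w) = T.log_form w"
      by (simp add: T.cartier_funpow_log_form)
    from T.residue_cartier_fixed[OF rational A w this] show ?thesis
      by (simp add: Fq R_def residues_def)
  qed
  have sub: "W' \<subseteq> W"
    by (auto simp: W'_def)
  have "linear_code Fq (R ` W')"
    unfolding linear_code_def
  proof (intro conjI ballI allI)
    show "0 \<in> R ` W'"
      using W'(1) R(1) by (metis image_eqI)
    fix c d assume "c \<in> R ` W'" "d \<in> R ` W'"
    then obtain w w' where w: "w \<in> W'" "w' \<in> W'" "c = R w" "d = R w'"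
      by blast
    then have "w \<in> W" "w' \<in> W"
      using sub by auto
    from R(2)[OF this] have "c + d = R (w + w')"
      by (simp add: w)
    with W'(2)[OF w(1,2)] show "c + d \<in> R ` W'"
      by blast
  next
    fix a c assume "a \<in> Fq" "c \<in> R ` W'"
    then obtain w where w: "w \<in> W'" "c = R w"
      by blast
    then have "w \<in> W"
      using sub by auto
    from R(3)[OF this] have "a *s c = R (emb a * w)"
      by (simp add: w)
    with W'_scale[OF \<open>a \<in> Fq\<close> w(1)] show "a *s c \<in> R ` W'"
      by blast
  qed (auto intro: in_Fq)
  moreover have "linear_code Fq (subfield_subcode Fq (R ` W))"
    unfolding linear_code_def
  proof (intro conjI ballI allI)
    have "0 \<in> R ` W"
      using W(1) R(1) by (metis image_eqI)
    then show "0 \<in> subfield_subcode Fq (R ` W)"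
      using is_subfieldD(1)[OF assms(6)] by (simp add: subfield_subcode_def)
    fix c d assume cd: "c \<in> subfield_subcode Fq (R ` W)" "d \<in> subfield_subcode Fq (R ` W)"
    then obtain w w' where w: "w \<in> W" "w' \<in> W" "c = R w" "d = R w'"
      by (auto simp: subfield_subcode_def)
    have "c + d \<in> R ` W"
      using W(2)[OF w(1,2)] R(2)[OF w(1,2)] w(3,4) by (metis image_eqI)
    then show "c + d \<in> subfield_subcode Fq (R ` W)"
      using cd is_subfieldD(7)[OF assms(6)] by (simp add: subfield_subcode_def)
  next
    fix a c assume a: "a \<in> Fq" and c: "c \<in> subfield_subcode Fq (R ` W)"
    then obtain w where w: "w \<in> W" "c = R w"
      by (auto simp: subfield_subcode_def)
    have "a *s c \<in> R ` W"
      using W(3)[OF w(1)] R(3)[OF w(1)] w(2) by (metis image_eqI)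
    then show "a *s c \<in> subfield_subcode Fq (R ` W)"
      using a c is_subfieldD(4)[OF assms(6)] by (simp add: subfield_subcode_def)
  qed (auto simp: subfield_subcode_def)
  moreover have "R ` W' \<subseteq> subfield_subcode Fq (R ` W)"
    using sub in_Fq by (auto simp: subfield_subcode_def)
  ultimately show ?thesis
    unfolding subcode_def AG Car by blast
qed

end
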